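(* The following equalities of bimodal logics hold: 1. $\mathsf{K4}\times_d\mathsf{K4}=\langle\mathsf{K4},\mathsf{K4}\rangle$; 2. $\mathsf{K4}\times_d\mathsf{D4}=\langle\mathsf{K4},\mathsf{D4}\rangle$; 3. $\mathsf{D4}\times_d\mathsf{K4}=\langle\mathsf{D4},\mathsf{K4}\rangle$; 4. $\mathsf{D4}\times_d\mathsf{D4}=\mathsf{D4}*\mathsf{D4}$.
   Context: A (normal modal) logic is a set of modal formulas (built from propositional letters, $\bot$, $\to$, $\Box_i$) containing all classical tautologies and $\Box_i(p\to q)\to(\Box_i p\to\Box_i q)$, closed under substitution, modus ponens and $A/\Box_i A$. $\mathsf{K}_n$ is the minimal one with $n$ modalities, $\mathsf K=\mathsf K_1$, and $\mathsf{L}+\Gamma$ is the minimal logic containing $\mathsf{L}\cup\Gamma$. $\mathsf{K4}=\mathsf K+\Box p\to\Box\Box p$ and $\mathsf{D4}=\mathsf{K4}+\lnot\Box\bot$. A formula is closed if it contains no propositional letters. Fusion: $\mathsf{L}_1*\mathsf{L}_2=\mathsf{K}_2+\mathsf{L}_1'+\mathsf{L}_2'$, where $\mathsf{L}_i'$ is $\mathsf{L}_i$ with every $\Box$ replaced by $\Box_i$. Let $\Delta=\{B\to\Box_2B : B \text{ closed and } \Box_2\text{-free}\}\cup\{B\to\Box_1B: B\text{ closed and }\Box_1\text{-free}\}$ and $\langle \mathsf{L}_1,\mathsf{L}_2\rangle=\mathsf{L}_1*\mathsf{L}_2+\Delta$. A neighborhood frame (n-frame) is $(X,\tau)$ with $X\neq\varnothing$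 and each $\tau(x)$ a filter on $X$ (possibly containing $\varnothing$); an n-2-frame $(X,\tau_1,\tau_2)$ has two such functions. For a valuation, $x\models\Box_iA$ iff there is $U\in\tau_i(x)$ with $y\models A$ for all $y\in U$; Boolean connectives as usual; validity means truth at all points under all valuations. Product of n-frames: $(X_1,\tau_1)\times(X_2,\tau_2)=(X_1\times X_2,\tau_1^h,\tau_2^v)$, where $\tau_1^h(x_1,x_2)=\{U: \exists V\in\tau_1(x_1)\ V\times\{x_2\}\subseteq U\}$ and $\tau_2^v(x_1,x_2)=\{U:\exists V\in\tau_2(x_2)\ \{x_1\}\times V\subseteq U\}$. Derivational semantics: for a topological space $\mathfrak X=(X,T)$ ($X\ne\varnothing$), let $\tau_d^{\mathfrak X}(x)=\{U\subseteq X: \exists U'\in T\ (x\in U',\ U'\setminus\{x\}\subseteq U)\}$ and $\mathcal N_d(\mathfrak X)=(X,\tau_d^{\mathfrak X})$. $\mathfrak X\models_d A$ means that $A$ is valid in the n-frame $\mathcal N_d(\mathfrak X)$; $\mathfrak X\models_d\mathsf L$ means $\mathfrak X\models_dA$ for all $A\in\mathsf L$. For the product of topological spaces (the bitopological product with horizontal and vertical topologies, not the Tychonoff product), $\mathfrak X_1\times\mathfrak X_2\models_dA$ means that the bimodal formula $A$ is valid in the n-2-frame $\mathcal N_d(\mathfrak X_1)\times\mathcal N_d(\mathfrak X_2)$. Finally, $\mathsf L_1\times_d\mathsf L_2$ is the set of all bimodal formulas $A$ such that $\mathfrak X_1\times\mathfrak X_2\models_dA$ for all topological spaces $\mathfrak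 X_1,\mathfrak X_2$ with $\mathfrak X_1\models_d\mathsf L_1$ and $\mathfrak X_2\models_d\mathsf L_2$. *)

theory Defs
  imports "HOL-Analysis.Abstract_Topology"
begin

section \<open>Modal formulas and normal modal logics\<close>

text \<open>
  The type parameter \<open>'m\<close> indexes the boxes: \<open>unit\<close> gives the unimodal language, the
  two-element type \<open>modality\<close> below the bimodal one.  \<open>boxes A\<close> is the set of indices of the boxes
  occurring in \<open>A\<close>, and \<open>relabel f A\<close> replaces every \<open>Box i\<close> in \<open>A\<close> by \<open>Box (f i)\<close>.
\<close>

datatype (boxes: 'm) fm =
    Letter nat
  | Bot
  | Imp "'m fm" "'m fm"  (infixr \<open>\<^bold>\<rightarrow>\<close> 55)
  | Box 'm "'m fm"
  for map: relabel

datatype modality = M1 | M2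

abbreviation Neg :: "'m fm \<Rightarrow> 'm fm" where
  "Neg A \<equiv> A \<^bold>\<rightarrow> Bot"

primrec letters :: "'m fm \<Rightarrow> nat set" where
  "letters (Letter p) = {p}"
| "letters Bot = {}"
| "letters (A \<^bold>\<rightarrow> B) = letters A \<union> letters B"
| "letters (Box i A) = letters A"

definition closed_fm :: "'m fm \<Rightarrow> bool" where
  "closed_fm A \<longleftrightarrow> letters A = {}"

primrec subst :: "(nat \<Rightarrow> 'm fm) \<Rightarrow> 'm fm \<Rightarrow> 'm fm" where
  "subst s (Letter p) = s p"
| "subst s Bot = Bot"
| "subst s (A \<^bold>\<rightarrow> B) = subst s A \<^bold>\<rightarrow> subst s B"
| "subst s (Box i A) = Box i (subst s A)"

text \<open>Letters and boxed formulas are the propositional atoms of a classical tautology.\<close>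

primrec peval :: "('m fm \<Rightarrow> bool) \<Rightarrow> 'm fm \<Rightarrow> bool" where
  "peval v (Letter p) \<longleftrightarrow> v (Letter p)"
| "peval v Bot \<longleftrightarrow> False"
| "peval v (A \<^bold>\<rightarrow> B) \<longleftrightarrow> (peval v A \<longrightarrow> peval v B)"
| "peval v (Box i A) \<longleftrightarrow> v (Box i A)"

definition tautology :: "'m fm \<Rightarrow> bool" where
  "tautology A \<longleftrightarrow> (\<forall>v. peval v A)"

definition normal_logic :: "'m fm set \<Rightarrow> bool" where
  "normal_logic L \<longleftrightarrow>
     (\<forall>A. tautology A \<longrightarrow> A \<in> L) \<and>
     (\<forall>i. Box i (Letter 0 \<^bold>\<rightarrow> Letter 1) \<^bold>\<rightarrow> (Box i (Letter 0) \<^bold>\<rightarrow> Box i (Letter 1)) \<in> L) \<and>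
     (\<forall>s. \<forall>A\<in>L. subst s A \<in> L) \<and>
     (\<forall>A B. A \<in> L \<longrightarrow> A \<^bold>\<rightarrow> B \<in> L \<longrightarrow> B \<in> L) \<and>
     (\<forall>i. \<forall>A\<in>L. Box i A \<in> L)"

definition K_logic :: "'m fm set" where
  "K_logic = \<Inter>{L. normal_logic L}"

definition extend :: "'m fm set \<Rightarrow> 'm fm set \<Rightarrow> 'm fm set"  (infixl \<open>\<^bold>+\<close> 65) where
  "L \<^bold>+ G = \<Inter>{L'. normal_logic L' \<and> L \<union> G \<subseteq> L'}"

definition K4 :: "unit fm set" where
  "K4 = K_logic \<^bold>+ {Box () (Letter 0) \<^bold>\<rightarrow> Box () (Box () (Letter 0))}"

definition D4 :: "unit fm set" where
  "D4 = K4 \<^bold>+ {Neg (Box () Bot)}"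

definition fusion :: "unit fm set \<Rightarrow> unit fm set \<Rightarrow> modality fm set"  (infixl \<open>\<^bold>*\<close> 70) where
  "L1 \<^bold>* L2 = K_logic \<^bold>+ relabel (\<lambda>_. M1) ` L1 \<^bold>+ relabel (\<lambda>_. M2) ` L2"

definition Delta :: "modality fm set" where
  "Delta = {B \<^bold>\<rightarrow> Box M2 B | B. closed_fm B \<and> M2 \<notin> boxes B}
         \<union> {B \<^bold>\<rightarrow> Box M1 B | B. closed_fm B \<and> M1 \<notin> boxes B}"

definition fusion_Delta :: "unit fm set \<Rightarrow> unit fm set \<Rightarrow> modality fm set"
    (\<open>\<langle>_, _\<rangle>\<close>) where
  "\<langle>L1, L2\<rangle> = L1 \<^bold>* L2 \<^bold>+ Delta"


section \<open>Neighborhood frames\<close>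

record ('m, 'a) nframe =
  points :: "'a set"
  nbhds :: "'m \<Rightarrow> 'a \<Rightarrow> 'a set set"

definition filter_on :: "'a set \<Rightarrow> 'a set set \<Rightarrow> bool" where
  "filter_on X F \<longleftrightarrow>
     F \<subseteq> Pow X \<and> X \<in> F \<and>
     (\<forall>U\<in>F. \<forall>V\<in>F. U \<inter> V \<in> F) \<and>
     (\<forall>U\<in>F. \<forall>V. U \<subseteq> V \<and> V \<subseteq> X \<longrightarrow> V \<in> F)"

definition is_nframe :: "('m, 'a) nframe \<Rightarrow> bool" where
  "is_nframe F \<longleftrightarrow> points F \<noteq> {} \<and> (\<forall>i. \<forall>x\<in>points F. filter_on (points F) (nbhds F i x))"

primrec sat :: "('m, 'a) nframe \<Rightarrow> (nat \<Rightarrow> 'a set) \<Rightarrow> 'a \<Rightarrow> 'm fm \<Rightarrow> bool" where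
  "sat F V x (Letter p) \<longleftrightarrow> x \<in> V p"
| "sat F V x Bot \<longleftrightarrow> False"
| "sat F V x (A \<^bold>\<rightarrow> B) \<longleftrightarrow> (sat F V x A \<longrightarrow> sat F V x B)"
| "sat F V x (Box i A) \<longleftrightarrow> (\<exists>U\<in>nbhds F i x. \<forall>y\<in>U. sat F V y A)"

definition valid :: "('m, 'a) nframe \<Rightarrow> 'm fm \<Rightarrow> bool" where
  "valid F A \<longleftrightarrow> (\<forall>V. (\<forall>p. V p \<subseteq> points F) \<longrightarrow> (\<forall>x\<in>points F. sat F V x A))"

definition horizontal ::
    "(unit, 'a) nframe \<Rightarrow> (unit, 'b) nframe \<Rightarrow> 'a \<times> 'b \<Rightarrow> ('a \<times> 'b) set set" where
  "horizontal F1 F2 = (\<lambda>(x1, x2).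
     {U. U \<subseteq> points F1 \<times> points F2 \<and> (\<exists>V\<in>nbhds F1 () x1. V \<times> {x2} \<subseteq> U)})"

definition vertical ::
    "(unit, 'a) nframe \<Rightarrow> (unit, 'b) nframe \<Rightarrow> 'a \<times> 'b \<Rightarrow> ('a \<times> 'b) set set" where
  "vertical F1 F2 = (\<lambda>(x1, x2).
     {U. U \<subseteq> points F1 \<times> points F2 \<and> (\<exists>V\<in>nbhds F2 () x2. {x1} \<times> V \<subseteq> U)})"

definition nprod ::
    "(unit, 'a) nframe \<Rightarrow> (unit, 'b) nframe \<Rightarrow> (modality, 'a \<times> 'b) nframe" where
  "nprod F1 F2 =
     \<lparr>points = points F1 \<times> points F2,
      nbhds = case_modality (horizontal F1 F2) (vertical F1 F2)\<rparr>"

lemma is_nframe_nprod: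
  assumes "is_nframe F1" "is_nframe F2"
  shows "is_nframe (nprod F1 F2)"
proof -
  have "filter_on (points F1 \<times> points F2) (horizontal F1 F2 (x, y))"
    if "x \<in> points F1" "y \<in> points F2" for x y
  proof -
    have F: "filter_on (points F1) (nbhds F1 () x)"
      using assms that by (simp add: is_nframe_def)
    have "U \<inter> W \<in> horizontal F1 F2 (x, y)"
      if "U \<in> horizontal F1 F2 (x, y)" "W \<in> horizontal F1 F2 (x, y)" for U W
    proof -
      obtain U' W' where "U' \<in> nbhds F1 () x" "U' \<times> {y} \<subseteq> U"
          "W' \<in> nbhds F1 () x" "W' \<times> {y} \<subseteq> W"
        using \<open>U \<in> _\<close> \<open>W \<in> _\<close> by (auto simp: horizontal_def)
      moreover from this have "U' \<inter> W' \<in> nbhds F1 () x"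
        using F by (simp add: filter_on_def)
      moreover have "(U' \<inter> W') \<times> {y} \<subseteq> U \<inter> W"
        using calculation by auto
      ultimately show ?thesis
        using \<open>U \<in> _\<close> by (auto simp: horizontal_def)
    qed
    moreover have "points F1 \<times> points F2 \<in> horizontal F1 F2 (x, y)"
      using F \<open>y \<in> points F2\<close> by (auto simp: horizontal_def filter_on_def)
    moreover have "horizontal F1 F2 (x, y) \<subseteq> Pow (points F1 \<times> points F2)"
      by (auto simp: horizontal_def)
    moreover have "W \<in> horizontal F1 F2 (x, y)"
      if "U \<in> horizontal F1 F2 (x, y)" "U \<subseteq> W \<and> W \<subseteq> points F1 \<times> points F2" for U W
      using that by (simp add: horizontal_def) (meson order_trans)
    ultimately show ?thesis
      unfolding filter_on_def by simp
  qed
  moreover have "filter_on (points F1 \<times> points F2) (vertical F1 F2 (x, y))"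
    if "x \<in> points F1" "y \<in> points F2" for x y
  proof -
    have F: "filter_on (points F2) (nbhds F2 () y)"
      using assms that by (simp add: is_nframe_def)
    have "U \<inter> W \<in> vertical F1 F2 (x, y)"
      if "U \<in> vertical F1 F2 (x, y)" "W \<in> vertical F1 F2 (x, y)" for U W
    proof -
      obtain U' W' where "U' \<in> nbhds F2 () y" "{x} \<times> U' \<subseteq> U"
          "W' \<in> nbhds F2 () y" "{x} \<times> W' \<subseteq> W"
        using \<open>U \<in> _\<close> \<open>W \<in> _\<close> by (auto simp: vertical_def)
      moreover from this have "U' \<inter> W' \<in> nbhds F2 () y"
        using F by (simp add: filter_on_def)
      moreover have "{x} \<times> (U' \<inter> W') \<subseteq> U \<inter> W"
        using calculation by auto
      ultimately show ?thesis
        using \<open>U \<in> _\<close> by (auto simp: vertical_def)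
    qed
    moreover have "points F1 \<times> points F2 \<in> vertical F1 F2 (x, y)"
      using F \<open>x \<in> points F1\<close> by (auto simp: vertical_def filter_on_def)
    moreover have "vertical F1 F2 (x, y) \<subseteq> Pow (points F1 \<times> points F2)"
      by (auto simp: vertical_def)
    moreover have "W \<in> vertical F1 F2 (x, y)"
      if "U \<in> vertical F1 F2 (x, y)" "U \<subseteq> W \<and> W \<subseteq> points F1 \<times> points F2" for U W
      using that by (simp add: vertical_def) (meson order_trans)
    ultimately show ?thesis
      unfolding filter_on_def by simp
  qed
  ultimately show ?thesis
    using assms by (auto simp: is_nframe_def nprod_def split: modality.split)
qed


section \<open>Derivational semantics\<close>

definition deriv_nframe :: "'a topology \<Rightarrow> (unit, 'a) nframe" where
  "deriv_nframe X =
     \<lparr>points = topspace X,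
      nbhds = (\<lambda>_ x. {U. U \<subseteq> topspace X \<and> (\<exists>U'. openin X U' \<and> x \<in> U' \<and> U' - {x} \<subseteq> U)})\<rparr>"

lemma is_nframe_deriv_nframe:
  assumes "topspace X \<noteq> {}"
  shows "is_nframe (deriv_nframe X)"
proof -
  have "filter_on (topspace X)
      {U. U \<subseteq> topspace X \<and> (\<exists>U'. openin X U' \<and> x \<in> U' \<and> U' - {x} \<subseteq> U)}" (is "filter_on _ ?F")
    if "x \<in> topspace X" for x
  proof -
    have "U \<inter> W \<in> ?F" if UW: "U \<in> ?F" "W \<in> ?F" for U W
    proof -
      obtain U' W' where "openin X U'" "x \<in> U'" "U' - {x} \<subseteq> U"
          "openin X W'" "x \<in> W'" "W' - {x} \<subseteq> W"
        using UW by blast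
      then have "openin X (U' \<inter> W') \<and> x \<in> U' \<inter> W' \<and> U' \<inter> W' - {x} \<subseteq> U \<inter> W"
        by auto
      then show ?thesis
        using UW by blast
    qed
    moreover have "topspace X \<in> ?F"
      using that by (auto intro: exI[of _ "topspace X"])
    moreover have "W \<in> ?F" if "U \<in> ?F" "U \<subseteq> W \<and> W \<subseteq> topspace X" for U W
      using that by (simp, meson order_trans)
    moreover have "?F \<subseteq> Pow (topspace X)"
      by auto
    ultimately show ?thesis
      unfolding filter_on_def by meson
  qed
  then show ?thesis
    using assms by (simp add: is_nframe_def deriv_nframe_def)
qed

definition d_models :: "'a topology \<Rightarrow> unit fm set \<Rightarrow> bool" where
  "d_models X L \<longleftrightarrow> (\<forall>A\<in>L. valid (deriv_nframe X) A)"

definition d_models_prod :: "'a topology \<Rightarrow> 'b topology \<Rightarrow> modality fm \<Rightarrow> bool" where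
  "d_models_prod X1 X2 A \<longleftrightarrow> valid (nprod (deriv_nframe X1) (deriv_nframe X2)) A"

text \<open>
  A definition in HOL cannot quantify over all types, so the d-product is relative to two types from
  which the points of the spaces are drawn.  The carrier \<open>topspace X\<close> is an arbitrary nonempty
  subset of its type, so every nonempty space whose cardinality is at most that of the type is
  covered up to homeomorphism.  Claims about all spaces are to be stated for all infinite types
  \<open>'a\<close> and \<open>'b\<close>; over finite types only finite spaces would be covered.
\<close>

definition d_product ::
    "'a itself \<Rightarrow> 'b itself \<Rightarrow> unit fm set \<Rightarrow> unit fm set \<Rightarrow> modality fm set" where
  "d_product _ _ L1 L2 =
     {A. \<forall>(X1 :: 'a topology) (X2 :: 'b topology).
           topspace X1 \<noteq> {} \<and> topspace X2 \<noteq> {} \<and> d_models X1 L1 \<and> d_models X2 L2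
           \<longrightarrow> d_models_prod X1 X2 A}"

end

(* Completeness.  If A is not in the logic, take a countable submodel W of its canonical model that
   contains a world w0 refuting A.  By Delta, a move along the i-th relation preserves the closed
   theory of a world in the other modality, so a world has two closed types, each changed only by its
   own relation; and if an i-type t sees an i-type t' canonically, then every world of type t sees
   one of type t'.  Hence whether a sequence of horizontal moves, each labelled by a world whose type
   is to be reached, can be performed is decided by the types alone, independently of the vertical
   moves.  A point of the i-th space is such a sequence of moves with time stamps; a neighborhood of
   a sequence consists of its extensions by moves after some time k.  Executing a horizontal and a
   vertical sequence in the order of the time stamps sends a point of the product to a world of W.
   Once k exceeds all times of the other coordinate, the extensions are the moves made at the very
   end, so by transitivity the map preserves and reflects the truth of boxed formulas.

   D4 * D4 decides every closed formula and therefore contains Delta. *)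

theory Submission
  imports Defs "HOL-Library.Countable_Set"
begin

text \<open>A countable language leaves only countably many witness functions in the closure
  argument, which keeps the submodel and the histories over it countable.\<close>

instance modality :: countable
  by countable_datatype

instance fm :: (countable) countable
  by countable_datatype


(* nframe.extend_def would otherwise shadow the definition of \<^bold>+. *)
hide_fact (open) nframe.extend_def


section \<open>Normal logics\<close>

lemma normal_logic_tautology: "normal_logic L \<Longrightarrow> tautology A \<Longrightarrow> A \<in> L"
  unfolding normal_logic_def by meson

lemma normal_logic_mp: "normal_logic L \<Longrightarrow> A \<^bold>\<rightarrow> B \<in> L \<Longrightarrow> A \<in> L \<Longrightarrow> B \<in> L"
  unfolding normal_logic_def by meson

lemma normal_logic_nec: "normal_logic L \<Longrightarrow> A \<in> L \<Longrightarrow> Box i A \<in> L"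
  unfolding normal_logic_def by meson

lemma normal_logic_subst: "normal_logic L \<Longrightarrow> A \<in> L \<Longrightarrow> subst s A \<in> L"
  unfolding normal_logic_def by meson

lemma normal_logic_distrib:
  assumes "normal_logic L"
  shows "Box i (A \<^bold>\<rightarrow> B) \<^bold>\<rightarrow> (Box i A \<^bold>\<rightarrow> Box i B) \<in> L"
proof -
  have "Box i (Letter 0 \<^bold>\<rightarrow> Letter 1) \<^bold>\<rightarrow> (Box i (Letter 0) \<^bold>\<rightarrow> Box i (Letter 1)) \<in> L"
    using assms unfolding normal_logic_def by meson
  from normal_logic_subst[OF assms this, of "\<lambda>p. if p = 0 then A else B"] show ?thesis
    by simp
qed

lemma normal_logic_Inter:
  assumes "\<And>L. L \<in> S \<Longrightarrow> normal_logic L"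
  shows "normal_logic (\<Inter>S)"
  unfolding normal_logic_def
proof (intro conjI allI ballI impI InterI)
  fix A B L assume "A \<in> \<Inter>S" "A \<^bold>\<rightarrow> B \<in> \<Inter>S" and L: "L \<in> S"
  then have "A \<in> L" "A \<^bold>\<rightarrow> B \<in> L" by auto
  then show "B \<in> L"
    using normal_logic_mp[OF assms[OF L]] by simp
qed (simp_all add: assms normal_logic_tautology normal_logic_distrib normal_logic_subst
  normal_logic_nec)

lemma normal_logic_extend: "normal_logic (L \<^bold>+ G)"
  unfolding extend_def by (rule normal_logic_Inter) simp

lemma extend_upper: "L \<subseteq> L \<^bold>+ G" "G \<subseteq> L \<^bold>+ G"
  unfolding extend_def by auto

lemma K_logic_least: "normal_logic L \<Longrightarrow> K_logic \<subseteq> L"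
  unfolding K_logic_def by auto

lemma extend_least: "normal_logic L' \<Longrightarrow> L \<subseteq> L' \<Longrightarrow> G \<subseteq> L' \<Longrightarrow> L \<^bold>+ G \<subseteq> L'"
  unfolding extend_def by auto

lemma relabel_fusion: "relabel (\<lambda>_. M1) ` L1 \<subseteq> L1 \<^bold>* L2" "relabel (\<lambda>_. M2) ` L2 \<subseteq> L1 \<^bold>* L2"
  unfolding fusion_def using extend_upper by blast+

lemma fusion_least:
  assumes "normal_logic L" "relabel (\<lambda>_. M1) ` L1 \<subseteq> L" "relabel (\<lambda>_. M2) ` L2 \<subseteq> L"
  shows "L1 \<^bold>* L2 \<subseteq> L"
  unfolding fusion_def by (intro extend_least K_logic_least assms)

lemma K4_subset_D4: "K4 \<subseteq> D4"
  unfolding D4_def by (rule extend_upper)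

lemma axiom_4_in_K4: "Box () (Letter 0) \<^bold>\<rightarrow> Box () (Box () (Letter 0)) \<in> K4"
  unfolding K4_def using extend_upper by blast

lemma axiom_D_in_D4: "Neg (Box () Bot) \<in> D4"
  unfolding D4_def using extend_upper by blast

lemma normal_logic_4:
  assumes "normal_logic L" "relabel (\<lambda>_. i) ` K4 \<subseteq> L"
  shows "Box i A \<^bold>\<rightarrow> Box i (Box i A) \<in> L"
proof -
  have "Box i (Letter 0) \<^bold>\<rightarrow> Box i (Box i (Letter 0)) \<in> L"
    using imageI[OF axiom_4_in_K4, of "relabel (\<lambda>_. i)"] assms(2) by auto
  from normal_logic_subst[OF assms(1) this, of "\<lambda>_. A"] show ?thesis
    by simp
qed

lemma relabel_D:
  assumes "relabel (\<lambda>_. i) ` D4 \<subseteq> L"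
  shows "Neg (Box i Bot) \<in> L"
  using imageI[OF axiom_D_in_D4, of "relabel (\<lambda>_. i)"] assms by auto

section \<open>Closed formulas over serial logics\<close>

text \<open>Without letters, provability can be computed along the formula. A provable
  \<open>B\<close> is boxed by necessitation, while for a refutable one \<open>Box i B\<close>
  implies \<open>Box i Bot\<close>, which seriality refutes.\<close>

lemma closed_fm_decided:
  assumes L: "normal_logic L" and D: "\<And>i. Neg (Box i Bot) \<in> L" and "closed_fm B"
  shows "B \<in> L \<or> Neg B \<in> L"
  using \<open>closed_fm B\<close>
proof (induction B)
  case (Letter p)
  then show ?case by (simp add: closed_fm_def)
next
  case Bot
  then show ?case by (simp add: normal_logic_tautology[OF L] tautology_def)
next
  case (Imp A B)
  have t: "Neg A \<^bold>\<rightarrow> (A \<^bold>\<rightarrow> B) \<in> L" "B \<^bold>\<rightarrow> (A \<^bold>\<rightarrow> B) \<in> L" "A \<^bold>\<rightarrow> (Neg B \<^bold>\<rightarrow> Neg (A \<^bold>\<rightarrow> B)) \<in> L"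
    by (simp_all add: normal_logic_tautology[OF L] tautology_def)
  have "A \<in> L \<or> Neg A \<in> L" "B \<in> L \<or> Neg B \<in> L"
    using Imp by (simp_all add: closed_fm_def)
  then consider "Neg A \<in> L" | "B \<in> L" | "A \<in> L" "Neg B \<in> L"
    by blast
  then show ?case
  proof cases
    case 1
    then show ?thesis using normal_logic_mp[OF L t(1)] by simp
  next
    case 2
    then show ?thesis using normal_logic_mp[OF L t(2)] by simp
  next
    case 3
    then show ?thesis using normal_logic_mp[OF L normal_logic_mp[OF L t(3)]] by simp
  qed
next
  case (Box i B)
  then have "B \<in> L \<or> Neg B \<in> L"
    by (simp add: closed_fm_def)
  then show ?case
  proof
    assume "B \<in> L"
    then show ?thesis using normal_logic_nec[OF L] by blast
  next
    assume "Neg B \<in> L"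
    then have "Box i B \<^bold>\<rightarrow> Box i Bot \<in> L"
      using normal_logic_mp[OF L normal_logic_distrib[OF L] normal_logic_nec[OF L]] by simp
    moreover have "(Box i B \<^bold>\<rightarrow> Box i Bot) \<^bold>\<rightarrow> (Neg (Box i Bot) \<^bold>\<rightarrow> Neg (Box i B)) \<in> L"
      by (rule normal_logic_tautology[OF L]) (auto simp: tautology_def)
    ultimately have "Neg (Box i B) \<in> L"
      using D[of i] normal_logic_mp[OF L] by metis
    then show ?thesis ..
  qed
qed

text \<open>For a decided \<open>B\<close> the implication from \<open>B\<close> to
  \<open>Box i B\<close> is trivial: its conclusion follows by necessitation or its premise is
  refutable.\<close>

lemma Delta_subset_if_serial:
  assumes L: "normal_logic L" and D: "\<And>i. Neg (Box i Bot) \<in> L"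
  shows "Delta \<subseteq> L"
proof -
  have "B \<^bold>\<rightarrow> Box i B \<in> L" if "closed_fm B" for B i
  proof -
    have "Box i B \<^bold>\<rightarrow> (B \<^bold>\<rightarrow> Box i B) \<in> L" "Neg B \<^bold>\<rightarrow> (B \<^bold>\<rightarrow> Box i B) \<in> L"
      by (simp_all add: normal_logic_tautology[OF L] tautology_def)
    then show ?thesis
      using closed_fm_decided[OF L D that] normal_logic_mp[OF L] normal_logic_nec[OF L] by metis
  qed
  then show ?thesis
    unfolding Delta_def by auto
qed


section \<open>Validity in neighborhood frames\<close>

lemma nbhds_subset: "is_nframe F \<Longrightarrow> x \<in> points F \<Longrightarrow> U \<in> nbhds F i x \<Longrightarrow> U \<subseteq> points F"
  unfolding is_nframe_def filter_on_def by (metis PowD subsetD)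

lemma nbhds_Int:
  "is_nframe F \<Longrightarrow> x \<in> points F \<Longrightarrow> U \<in> nbhds F i x \<Longrightarrow> U' \<in> nbhds F i x \<Longrightarrow> U \<inter> U' \<in> nbhds F i x"
  by (auto simp: is_nframe_def filter_on_def)

lemma points_in_nbhds: "is_nframe F \<Longrightarrow> x \<in> points F \<Longrightarrow> points F \<in> nbhds F i x"
  by (auto simp: is_nframe_def filter_on_def)

lemma sat_cong_letters:
  assumes "\<And>p. p \<in> letters A \<Longrightarrow> V p = V' p"
  shows "sat F V x A \<longleftrightarrow> sat F V' x A"
  using assms by (induction A arbitrary: x) auto

text \<open>The new valuation is cut down to the points because \<open>valid\<close> ranges over
  such valuations only; neighborhoods contain nothing but points, so truth at points is
  unaffected.\<close>

lemma sat_subst: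
  assumes "is_nframe F" "x \<in> points F"
  shows "sat F V x (subst s A) \<longleftrightarrow> sat F (\<lambda>p. {y \<in> points F. sat F V y (s p)}) x A"
  using assms(2)
proof (induction A arbitrary: x)
  case (Box i A)
  then have "(\<forall>y\<in>U. sat F V y (subst s A)) \<longleftrightarrow>
      (\<forall>y\<in>U. sat F (\<lambda>p. {y \<in> points F. sat F V y (s p)}) y A)" if "U \<in> nbhds F i x" for U
    using nbhds_subset[OF assms(1) Box.prems that] by blast
  then show ?case by simp
qed auto

lemma sat_tautology:
  assumes "tautology A"
  shows "sat F V x A"
proof -
  \<comment> \<open>At a fixed point, truth is a propositional valuation whose atoms are letters and
    boxed formulas.\<close>
  have "peval (sat F V x) B \<longleftrightarrow> sat F V x B" for B
    by (induction B) auto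
  then show ?thesis
    using assms by (auto simp: tautology_def)
qed

text \<open>Soundness of a generated logic thereby reduces to the validity of its
  generators.\<close>

lemma normal_logic_valid:
  assumes F: "is_nframe F"
  shows "normal_logic {A. valid F A}"
  unfolding normal_logic_def
proof (intro conjI allI ballI impI)
  fix A :: "'a fm" assume "tautology A"
  then show "A \<in> {A. valid F A}" by (simp add: valid_def sat_tautology)
next
  fix i
  show "Box i (Letter 0 \<^bold>\<rightarrow> Letter 1) \<^bold>\<rightarrow> (Box i (Letter 0) \<^bold>\<rightarrow> Box i (Letter 1)) \<in> {A. valid F A}"
    unfolding valid_def mem_Collect_eq sat.simps
  proof (intro allI ballI impI)
    fix V x
    assume x: "x \<in> points F"
      and "\<exists>U\<in>nbhds F i x. \<forall>y\<in>U. y \<in> V 0 \<longrightarrow> y \<in> V 1" "\<exists>U\<in>nbhds F i x. \<forall>y\<in>U. y \<in> V 0"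
    then obtain U U' where "U \<in> nbhds F i x" "\<forall>y\<in>U. y \<in> V 0 \<longrightarrow> y \<in> V 1"
      "U' \<in> nbhds F i x" "\<forall>y\<in>U'. y \<in> V 0"
      by blast
    then show "\<exists>U\<in>nbhds F i x. \<forall>y\<in>U. y \<in> V 1"
      using nbhds_Int[OF F x] by (intro bexI[of _ "U \<inter> U'"]) auto
  qed
next
  fix s :: "nat \<Rightarrow> 'a fm" and A assume "A \<in> {A. valid F A}"
  then show "subst s A \<in> {A. valid F A}"
    by (auto simp: valid_def sat_subst[OF F])
next
  fix A B :: "'a fm" assume "A \<in> {A. valid F A}" "A \<^bold>\<rightarrow> B \<in> {A. valid F A}"
  then show "B \<in> {A. valid F A}" by (simp add: valid_def)
next
  fix i and A :: "'a fm" assume "A \<in> {A. valid F A}"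
  then show "Box i A \<in> {A. valid F A}"
    unfolding valid_def mem_Collect_eq sat.simps
    by (intro allI impI ballI bexI[OF _ points_in_nbhds[OF F]]) simp_all
qed

section \<open>Truth in products of neighborhood frames\<close>

text \<open>The sets \<open>U \<times> {y}\<close> with \<open>U\<close> a neighborhood of
  \<open>x\<close> generate the horizontal filter, so the box is evaluated inside the row of
  \<open>y\<close>.\<close>

lemma sat_nprod_M1:
  assumes "is_nframe F1" "x \<in> points F1" "y \<in> points F2"
  shows "sat (nprod F1 F2) V (x, y) (Box M1 A) \<longleftrightarrow>
    (\<exists>U\<in>nbhds F1 () x. \<forall>x'\<in>U. sat (nprod F1 F2) V (x', y) A)" (is "?l \<longleftrightarrow> ?r")
proof
  assume ?l
  then show ?r
    by (simp add: nprod_def horizontal_def) blast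
next
  assume ?r
  then obtain U where U: "U \<in> nbhds F1 () x" "\<forall>x'\<in>U. sat (nprod F1 F2) V (x', y) A"
    by blast
  then have "U \<times> {y} \<in> nbhds (nprod F1 F2) M1 (x, y)"
    using nbhds_subset[OF assms(1,2) U(1)] assms(3) by (auto simp: nprod_def horizontal_def)
  then show ?l
    using U(2) by (simp del: split_paired_Ex) (metis (no_types, lifting) SigmaE singletonD)
qed

lemma sat_nprod_M2:
  assumes "is_nframe F2" "x \<in> points F1" "y \<in> points F2"
  shows "sat (nprod F1 F2) V (x, y) (Box M2 A) \<longleftrightarrow>
    (\<exists>U\<in>nbhds F2 () y. \<forall>y'\<in>U. sat (nprod F1 F2) V (x, y') A)" (is "?l \<longleftrightarrow> ?r")
proof
  assume ?l
  then show ?r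
    by (simp add: nprod_def vertical_def) blast
next
  assume ?r
  then obtain U where U: "U \<in> nbhds F2 () y" "\<forall>y'\<in>U. sat (nprod F1 F2) V (x, y') A"
    by blast
  then have "{x} \<times> U \<in> nbhds (nprod F1 F2) M2 (x, y)"
    using nbhds_subset[OF assms(1,3) U(1)] assms(2) by (auto simp: nprod_def vertical_def)
  then show ?l
    using U(2) by (simp del: split_paired_Ex) (metis (no_types, lifting) SigmaE singletonD)
qed

text \<open>With horizontal boxes only, evaluation never leaves the row of \<open>y\<close>, and all
  it sees of \<open>V\<close> is the slice at \<open>y\<close>.\<close>

lemma sat_nprod_relabel_M1:
  assumes "is_nframe F1" "x \<in> points F1" "y \<in> points F2"
  shows "sat (nprod F1 F2) V (x, y) (relabel (\<lambda>_. M1) A) \<longleftrightarrow> sat F1 (\<lambda>p. {x. (x, y) \<in> V p}) x A"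
  using assms(2)
proof (induction A arbitrary: x)
  case (Box i A)
  have "(\<forall>x'\<in>U. sat (nprod F1 F2) V (x', y) (relabel (\<lambda>_. M1) A)) \<longleftrightarrow>
      (\<forall>x'\<in>U. sat F1 (\<lambda>p. {x. (x, y) \<in> V p}) x' A)" if "U \<in> nbhds F1 () x" for U
    using nbhds_subset[OF assms(1) Box.prems that] Box.IH by (intro ball_cong) auto
  then show ?case
    unfolding fm.map sat_nprod_M1[OF assms(1) Box.prems assms(3)] by simp
qed auto

lemma sat_nprod_relabel_M2:
  assumes "is_nframe F2" "x \<in> points F1" "y \<in> points F2"
  shows "sat (nprod F1 F2) V (x, y) (relabel (\<lambda>_. M2) A) \<longleftrightarrow> sat F2 (\<lambda>p. {y. (x, y) \<in> V p}) y A"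
  using assms(3)
proof (induction A arbitrary: y)
  case (Box i A)
  have "(\<forall>y'\<in>U. sat (nprod F1 F2) V (x, y') (relabel (\<lambda>_. M2) A)) \<longleftrightarrow>
      (\<forall>y'\<in>U. sat F2 (\<lambda>p. {y. (x, y) \<in> V p}) y' A)" if "U \<in> nbhds F2 () y" for U
    using nbhds_subset[OF assms(1) Box.prems that] Box.IH by (intro ball_cong) auto
  then show ?case
    unfolding fm.map sat_nprod_M2[OF assms(1,2) Box.prems] by simp
qed auto

lemma valid_nprod_relabel_M1:
  assumes "is_nframe F1" "valid F1 A"
  shows "valid (nprod F1 F2) (relabel (\<lambda>_. M1) A)"
proof -
  have "sat (nprod F1 F2) V (x, y) (relabel (\<lambda>_. M1) A)"
    if "\<forall>p. V p \<subseteq> points F1 \<times> points F2" "x \<in> points F1" "y \<in> points F2" for V x y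
  proof -
    have "{x. (x, y) \<in> V p} \<subseteq> points F1" for p
      using that(1) by auto
    then show ?thesis
      using that(2,3) assms(2) unfolding sat_nprod_relabel_M1[OF assms(1) that(2,3)] valid_def
      by simp
  qed
  then show ?thesis
    by (auto simp: valid_def nprod_def)
qed

lemma valid_nprod_relabel_M2:
  assumes "is_nframe F2" "valid F2 A"
  shows "valid (nprod F1 F2) (relabel (\<lambda>_. M2) A)"
proof -
  have "sat (nprod F1 F2) V (x, y) (relabel (\<lambda>_. M2) A)"
    if "\<forall>p. V p \<subseteq> points F1 \<times> points F2" "x \<in> points F1" "y \<in> points F2" for V x y
  proof -
    have "{y. (x, y) \<in> V p} \<subseteq> points F2" for p
      using that(1) by auto
    then show ?thesis
      using that(2,3) assms(2) unfolding sat_nprod_relabel_M2[OF assms(1) that(2,3)] valid_def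
      by simp
  qed
  then show ?thesis
    by (auto simp: valid_def nprod_def)
qed

section \<open>Soundness for the product\<close>

text \<open>Presents a formula with one kind of box as a relabelled unimodal one, so that evaluation
  in rows and columns applies to the formulas of \<open>Delta\<close>.\<close>

lemma relabel_unit_relabel:
  assumes "boxes B \<subseteq> {i}"
  shows "relabel (\<lambda>_. i) (relabel (\<lambda>_. ()) B) = B"
proof -
  have "relabel (\<lambda>_. i) (relabel (\<lambda>_. ()) B) = relabel id B"
    unfolding fm.map_comp by (rule fm.map_cong) (use assms in auto)
  then show ?thesis by (simp add: fm.map_id)
qed

lemma letters_relabel [simp]: "letters (relabel f B) = letters B"
  by (induction B) auto

text \<open>The truth of a closed \<open>B\<close> with boxes of one direction depends on one
  coordinate only, and moves in the other direction fix that coordinate. The whole other space is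
  thus a neighborhood on which \<open>B\<close> stays true.\<close>

lemma valid_nprod_Delta:
  assumes F: "is_nframe F1" "is_nframe F2" and "A \<in> Delta"
  shows "valid (nprod F1 F2) A"
proof -
  have M: "{i. i \<noteq> M2} = {M1}" "{i. i \<noteq> M1} = {M2}"
    using modality.exhaust by blast+
  consider B where "A = B \<^bold>\<rightarrow> Box M2 B" "closed_fm B" "boxes B \<subseteq> {M1}"
    | B where "A = B \<^bold>\<rightarrow> Box M1 B" "closed_fm B" "boxes B \<subseteq> {M2}"
    using \<open>A \<in> Delta\<close> unfolding Delta_def M[symmetric] by blast
  then show ?thesis
  proof cases
    case (1 B)
    define B' where "B' = relabel (\<lambda>_. ()) B"
    have B: "B = relabel (\<lambda>_. M1) B'"
      using 1(3) by (simp add: B'_def relabel_unit_relabel)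
    \<comment> \<open>No letter occurs in \<open>B\<close>, so the empty valuation can stand for
      every slice of \<open>V\<close>.\<close>
    have *: "sat (nprod F1 F2) V (x, y) B \<longleftrightarrow> sat F1 (\<lambda>_. {}) x B'"
      if "x \<in> points F1" "y \<in> points F2" for V x y
      unfolding B sat_nprod_relabel_M1[OF F(1) that]
      by (rule sat_cong_letters) (use 1(2) in \<open>simp add: B'_def closed_fm_def\<close>)
    have "sat (nprod F1 F2) V (x, y) (Box M2 B)"
      if "x \<in> points F1" "y \<in> points F2" "sat (nprod F1 F2) V (x, y) B" for V x y
      unfolding sat_nprod_M2[OF F(2) that(1,2)]
      using that * by (intro bexI[OF _ points_in_nbhds[OF F(2) that(2)]]) simp
    then show ?thesis
      unfolding 1(1) valid_def by (auto simp: nprod_def simp del: sat.simps(4))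
  next
    case (2 B)
    define B' where "B' = relabel (\<lambda>_. ()) B"
    have B: "B = relabel (\<lambda>_. M2) B'"
      using 2(3) by (simp add: B'_def relabel_unit_relabel)
    have *: "sat (nprod F1 F2) V (x, y) B \<longleftrightarrow> sat F2 (\<lambda>_. {}) y B'"
      if "x \<in> points F1" "y \<in> points F2" for V x y
      unfolding B sat_nprod_relabel_M2[OF F(2) that]
      by (rule sat_cong_letters) (use 2(2) in \<open>simp add: B'_def closed_fm_def\<close>)
    have "sat (nprod F1 F2) V (x, y) (Box M1 B)"
      if "x \<in> points F1" "y \<in> points F2" "sat (nprod F1 F2) V (x, y) B" for V x y
      unfolding sat_nprod_M1[OF F(1) that(1,2)]
      using that * by (intro bexI[OF _ points_in_nbhds[OF F(1) that(1)]]) simp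
    then show ?thesis
      unfolding 2(1) valid_def by (auto simp: nprod_def simp del: sat.simps(4))
  qed
qed

lemma fusion_Delta_subset_d_product:
  "\<langle>L1, L2\<rangle> \<subseteq> d_product TYPE('a) TYPE('b) L1 L2"
proof -
  have "\<langle>L1, L2\<rangle> \<subseteq> {A. d_models_prod X1 X2 A}"
    if X: "topspace X1 \<noteq> {}" "topspace X2 \<noteq> {}" and d: "d_models X1 L1" "d_models X2 L2"
    for X1 :: "'a topology" and X2 :: "'b topology"
  proof -
    note F = is_nframe_deriv_nframe[OF X(1)] is_nframe_deriv_nframe[OF X(2)]
    show ?thesis
      unfolding fusion_Delta_def d_models_prod_def
      using d by (intro extend_least fusion_least normal_logic_valid is_nframe_nprod F)
        (auto simp: d_models_def valid_nprod_Delta[OF F] intro: valid_nprod_relabel_M1[OF F(1)]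
          valid_nprod_relabel_M2[OF F(2)])
  qed
  then show ?thesis
    unfolding d_product_def by blast
qed

lemma d_models_K4I:
  assumes "topspace X \<noteq> {}"
    "valid (deriv_nframe X) (Box () (Letter 0) \<^bold>\<rightarrow> Box () (Box () (Letter 0)))"
  shows "d_models X K4"
  using extend_least[OF normal_logic_valid[OF is_nframe_deriv_nframe[OF assms(1)]] K_logic_least]
    normal_logic_valid[OF is_nframe_deriv_nframe[OF assms(1)]] assms(2)
  unfolding d_models_def K4_def by blast

lemma d_models_D4I:
  assumes "topspace X \<noteq> {}" "d_models X K4" "valid (deriv_nframe X) (Neg (Box () Bot))"
  shows "d_models X D4"
proof -
  have "D4 \<subseteq> {A. valid (deriv_nframe X) A}"
    unfolding D4_def
    by (rule extend_least[OF normal_logic_valid[OF is_nframe_deriv_nframe[OF assms(1)]]])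
      (use assms in \<open>auto simp: d_models_def\<close>)
  then show ?thesis
    by (auto simp: d_models_def)
qed


section \<open>Maximal consistent sets\<close>

text \<open>Hypotheses are local: necessitation is confined to \<open>L\<close>, which is what makes
  the deduction theorem hold.\<close>

inductive_set ded :: "'m fm set \<Rightarrow> 'm fm set \<Rightarrow> 'm fm set" for L S where
  ax: "A \<in> L \<Longrightarrow> A \<in> ded L S"
| hyp: "A \<in> S \<Longrightarrow> A \<in> ded L S"
| mp: "A \<^bold>\<rightarrow> B \<in> ded L S \<Longrightarrow> A \<in> ded L S \<Longrightarrow> B \<in> ded L S"

lemma ded_mono: "S \<subseteq> S' \<Longrightarrow> A \<in> ded L S \<Longrightarrow> A \<in> ded L S'"
  by (rotate_tac, induction rule: ded.induct) (auto intro: ded.intros)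

lemma ded_tautology: "normal_logic L \<Longrightarrow> tautology A \<Longrightarrow> A \<in> ded L S"
  by (simp add: ded.ax normal_logic_tautology)

lemma ded_empty: "normal_logic L \<Longrightarrow> A \<in> ded L {} \<Longrightarrow> A \<in> L"
  by (rotate_tac, induction rule: ded.induct) (auto intro: normal_logic_mp)

lemma deduction:
  assumes L: "normal_logic L" and "A \<in> ded L (insert B S)"
  shows "B \<^bold>\<rightarrow> A \<in> ded L S"
  using assms(2)
proof induction
  case (ax A)
  then show ?case
    using ded_tautology[OF L, of "A \<^bold>\<rightarrow> (B \<^bold>\<rightarrow> A)"] by (auto simp: tautology_def intro: ded.intros)
next
  case (hyp A)
  then show ?case
    using ded_tautology[OF L, of "A \<^bold>\<rightarrow> (B \<^bold>\<rightarrow> A)" S] ded_tautology[OF L, of "A \<^bold>\<rightarrow> A" S]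
    by (auto simp: tautology_def intro: ded.hyp ded.mp[OF _ ded.hyp])
next
  case (mp A C)
  have "(B \<^bold>\<rightarrow> (A \<^bold>\<rightarrow> C)) \<^bold>\<rightarrow> ((B \<^bold>\<rightarrow> A) \<^bold>\<rightarrow> (B \<^bold>\<rightarrow> C)) \<in> ded L S"
    by (rule ded_tautology[OF L]) (simp add: tautology_def)
  then show ?case
    using mp.IH ded.mp by metis
qed

lemma ded_Neg_Neg:
  assumes "normal_logic L" "Neg (Neg A) \<in> ded L S"
  shows "A \<in> ded L S"
proof -
  have "Neg (Neg A) \<^bold>\<rightarrow> A \<in> ded L S"
    by (rule ded_tautology[OF assms(1)]) (simp add: tautology_def)
  then show ?thesis
    using assms(2) by (rule ded.mp)
qed

text \<open>Consistency and completeness together stand for maximality; deductive closure follows in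
  \<open>mcs_ded\<close>.\<close>

definition mcs :: "'m fm set \<Rightarrow> 'm fm set \<Rightarrow> bool" where
  "mcs L w \<longleftrightarrow> Bot \<notin> ded L w \<and> (\<forall>A. A \<in> w \<or> Neg A \<in> w)"

lemma mcs_ded:
  assumes "mcs L w" "A \<in> ded L w"
  shows "A \<in> w"
  using assms ded.mp[OF ded.hyp, of A Bot w L] by (auto simp: mcs_def)

lemma mcs_Bot: "mcs L w \<Longrightarrow> Bot \<notin> w"
  by (auto simp: mcs_def intro: ded.hyp)

lemma mcs_logic: "mcs L w \<Longrightarrow> A \<in> L \<Longrightarrow> A \<in> w"
  by (simp add: mcs_ded ded.ax)

lemma mcs_mp: "mcs L w \<Longrightarrow> A \<^bold>\<rightarrow> B \<in> w \<Longrightarrow> A \<in> w \<Longrightarrow> B \<in> w"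
  by (metis mcs_ded ded.mp ded.hyp)

lemma mcs_Neg: "mcs L w \<Longrightarrow> Neg A \<in> w \<longleftrightarrow> A \<notin> w"
  by (metis mcs_def mcs_mp mcs_Bot)

lemma mcs_Imp:
  assumes L: "normal_logic L" and w: "mcs L w"
  shows "A \<^bold>\<rightarrow> B \<in> w \<longleftrightarrow> (A \<in> w \<longrightarrow> B \<in> w)"
proof -
  have "Neg A \<^bold>\<rightarrow> (A \<^bold>\<rightarrow> B) \<in> w" "B \<^bold>\<rightarrow> (A \<^bold>\<rightarrow> B) \<in> w"
    by (auto intro!: mcs_logic[OF w] normal_logic_tautology[OF L] simp: tautology_def)
  then show ?thesis
    using mcs_mp[OF w] mcs_Neg[OF w] by blast
qed

text \<open>A derivation uses finitely many hypotheses; at modus ponens the larger of two chain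
  members serves both premises.\<close>

lemma ded_Union_chain:
  assumes "subset.chain \<A> C" "C \<noteq> {}" "A \<in> ded L (\<Union>C)"
  shows "\<exists>S\<in>C. A \<in> ded L S"
  using assms(3)
proof induction
  case (mp A B)
  then obtain S S' where S: "S \<in> C" "A \<^bold>\<rightarrow> B \<in> ded L S" "S' \<in> C" "A \<in> ded L S'"
    by blast
  then have "S \<subseteq> S' \<or> S' \<subseteq> S"
    using assms(1) by (auto simp: subset.chain_def)
  then show ?case
    using S ded_mono ded.mp by metis
qed (use assms(2) in \<open>auto intro: ded.intros\<close>)

text \<open>Zorn's lemma on the consistent supersets of \<open>S\<close>: the union of a chain is
  consistent since an inconsistency would already arise in one member.\<close>

lemma lindenbaum:
  assumes L: "normal_logic L" and S: "Bot \<notin> ded L S"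
  shows "\<exists>w. mcs L w \<and> S \<subseteq> w"
proof -
  let ?A = "{w. S \<subseteq> w \<and> Bot \<notin> ded L w}"
  have "\<exists>M\<in>?A. \<forall>X\<in>?A. M \<subseteq> X \<longrightarrow> X = M"
  proof (rule subset_Zorn_nonempty)
    show "?A \<noteq> {}" using S by blast
  next
    fix C assume C: "C \<noteq> {}" "subset.chain ?A C"
    then have "C \<subseteq> ?A" by (auto simp: subset.chain_def)
    then show "\<Union>C \<in> ?A"
      using C(1) ded_Union_chain[OF C(2,1), of Bot L] by blast
  qed
  then obtain M where "M \<in> ?A" and M_max: "\<forall>X\<in>?A. M \<subseteq> X \<longrightarrow> X = M"
    by (elim bexE)
  then have M: "S \<subseteq> M" "Bot \<notin> ded L M"
    by simp_all
  have max: "X = M" if "S \<subseteq> X" "Bot \<notin> ded L X" "M \<subseteq> X" for X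
    using M_max that by simp
  \<comment> \<open>By maximality \<open>insert A M\<close> is inconsistent, and the deduction
    theorem turns this into a refutation of \<open>A\<close>.\<close>
  have neg: "Neg A \<in> ded L M" if "A \<notin> M" for A
    using max[of "insert A M"] M that deduction[OF L] by blast
  \<comment> \<open>Were \<open>A\<close> and \<open>Neg A\<close> both missing, \<open>neg\<close>
    would derive \<open>Neg A\<close> and \<open>Neg (Neg A)\<close>, hence
    \<open>Bot\<close>.\<close>
  have "A \<in> M \<or> Neg A \<in> M" for A
    using neg ded.mp M(2) by blast
  then show ?thesis
    using M by (auto simp: mcs_def)
qed

lemma mcs_refuting:
  assumes L: "normal_logic L" and "A \<notin> L"
  shows "\<exists>w. mcs L w \<and> A \<notin> w"
proof -
  have "Bot \<notin> ded L {Neg A}"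
    using assms(2) deduction[OF L] ded_Neg_Neg[OF L] ded_empty[OF L] by blast
  then show ?thesis
    using lindenbaum[OF L] mcs_Neg by blast
qed

section \<open>The canonical relations\<close>

definition acc :: "'m \<Rightarrow> 'm fm set \<Rightarrow> 'm fm set \<Rightarrow> bool" where
  "acc i w v \<longleftrightarrow> (\<forall>A. Box i A \<in> w \<longrightarrow> A \<in> v)"

text \<open>Distribution and necessitation carry a derivation from the unboxed formulas of
  \<open>w\<close> under the box.\<close>

lemma mcs_ded_unbox:
  assumes L: "normal_logic L" and w: "mcs L w" and "A \<in> ded L {A. Box i A \<in> w}"
  shows "Box i A \<in> w"
  using assms(3)
proof induction
  case (ax A)
  then show ?case by (intro mcs_logic[OF w] normal_logic_nec[OF L])
next
  case (mp A B)
  have "Box i (A \<^bold>\<rightarrow> B) \<^bold>\<rightarrow> (Box i A \<^bold>\<rightarrow> Box i B) \<in> w"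
    by (intro mcs_logic[OF w] normal_logic_distrib[OF L])
  then show ?case
    using mp.IH mcs_mp[OF w] by blast
qed simp

text \<open>If \<open>Neg A\<close> were inconsistent with the unboxed formulas of \<open>w\<close>,
  these would derive \<open>A\<close>, and \<open>Box i A\<close> would be in
  \<open>w\<close>.\<close>

lemma acc_exists:
  assumes L: "normal_logic L" and w: "mcs L w" and "Box i A \<notin> w"
  shows "\<exists>v. mcs L v \<and> acc i w v \<and> A \<notin> v"
proof -
  have "Bot \<notin> ded L (insert (Neg A) {A. Box i A \<in> w})"
    using assms(3) deduction[OF L] ded_Neg_Neg[OF L] mcs_ded_unbox[OF L w] by blast
  then obtain v where v: "mcs L v" "insert (Neg A) {A. Box i A \<in> w} \<subseteq> v"
    using lindenbaum[OF L] by blast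
  then show ?thesis
    using mcs_Neg[OF v(1), of A] by (intro exI[of _ v]) (auto simp: acc_def)
qed

lemma acc_trans:
  assumes "mcs L u" "\<And>A. Box i A \<^bold>\<rightarrow> Box i (Box i A) \<in> L" "acc i u v" "acc i v w"
  shows "acc i u w"
  using assms mcs_logic mcs_mp unfolding acc_def by metis

section \<open>Closed types\<close>

definition closed_type :: "'m \<Rightarrow> 'm fm set \<Rightarrow> 'm fm set" where
  "closed_type i w = {A \<in> w. closed_fm A \<and> boxes A \<subseteq> {i}}"

lemma closed_fm_simps [simp]:
  "closed_fm Bot" "closed_fm (A \<^bold>\<rightarrow> B) \<longleftrightarrow> closed_fm A \<and> closed_fm B"
  "closed_fm (Box i A) \<longleftrightarrow> closed_fm A"
  by (auto simp: closed_fm_def)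

text \<open>\<open>acc\<close> applied to types says that one type sees the other. It passes down
  from worlds because boxing by \<open>i\<close> keeps a formula closed and free of the other
  box.\<close>

lemma acc_closed_type: "acc i w v \<Longrightarrow> acc i (closed_type i w) (closed_type i v)"
  by (simp add: acc_def closed_type_def)

text \<open>One inclusion suffices, since a type contains each closed \<open>i\<close>-formula or
  its negation.\<close>

lemma closed_type_eqI:
  assumes "mcs L w" "mcs L v" "closed_type i w \<subseteq> v"
  shows "closed_type i v = closed_type i w"
  using assms mcs_Neg[OF assms(1)] mcs_Neg[OF assms(2)]
  by (force simp: closed_type_def)

text \<open>Types are closed under conjunction, so the finitely many hypotheses taken from one can
  be collected in a single \<open>D\<close>.\<close>

lemma ded_Un_closed_type:
  assumes L: "normal_logic L" and u: "mcs L u" and "A \<in> ded L (S \<union> closed_type i u)"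
  shows "\<exists>D\<in>closed_type i u. D \<^bold>\<rightarrow> A \<in> ded L S"
  using assms(3)
proof induction
  case (ax A)
  \<comment> \<open>\<open>Neg Bot\<close> is the empty conjunction, for derivations that use
    nothing from the type.\<close>
  have "Neg Bot \<in> closed_type i u"
    using mcs_logic[OF u] normal_logic_tautology[OF L] by (simp add: closed_type_def tautology_def)
  moreover have "A \<^bold>\<rightarrow> (Neg Bot \<^bold>\<rightarrow> A) \<in> ded L S"
    by (rule ded_tautology[OF L]) (simp add: tautology_def)
  ultimately show ?case
    using ded.mp ded.ax[OF ax] by blast
next
  case (hyp A)
  have "Neg Bot \<in> closed_type i u"
    using mcs_logic[OF u] normal_logic_tautology[OF L] by (simp add: closed_type_def tautology_def)
  moreover have "A \<^bold>\<rightarrow> (Neg Bot \<^bold>\<rightarrow> A) \<in> ded L S" "A \<^bold>\<rightarrow> A \<in> ded L S"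
    by (rule ded_tautology[OF L], simp add: tautology_def)+
  ultimately show ?case
    using ded.mp ded.hyp hyp by blast
next
  case (mp A B)
  then obtain D E where DE: "D \<in> closed_type i u" "D \<^bold>\<rightarrow> (A \<^bold>\<rightarrow> B) \<in> ded L S"
    "E \<in> closed_type i u" "E \<^bold>\<rightarrow> A \<in> ded L S"
    by blast
  \<comment> \<open>The conjunction of \<open>D\<close> and \<open>E\<close>.\<close>
  let ?C = "Neg (D \<^bold>\<rightarrow> Neg E)"
  have "?C \<in> closed_type i u"
    using DE(1,3) by (simp add: closed_type_def mcs_Neg[OF u] mcs_Imp[OF L u] mcs_Bot[OF u])
  moreover have "(D \<^bold>\<rightarrow> (A \<^bold>\<rightarrow> B)) \<^bold>\<rightarrow> ((E \<^bold>\<rightarrow> A) \<^bold>\<rightarrow> (?C \<^bold>\<rightarrow> B)) \<in> ded L S"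
    by (rule ded_tautology[OF L]) (auto simp: tautology_def)
  ultimately show ?case
    using DE ded.mp by metis
qed

text \<open>The unboxed formulas of \<open>w\<close> are consistent with the type of
  \<open>u\<close>: a conflict would put \<open>Box i (Neg D)\<close> into \<open>w\<close> for some
  \<open>D\<close> in the type of \<open>u\<close>. Being closed, that formula would lie in the type
  of \<open>w\<close>, forcing \<open>Neg D\<close> into \<open>u\<close>.\<close>

lemma acc_lift:
  assumes L: "normal_logic L" and w: "mcs L w" and u: "mcs L u"
    and "acc i (closed_type i w) (closed_type i u)"
  shows "\<exists>v. mcs L v \<and> acc i w v \<and> closed_type i v = closed_type i u"
proof -
  have "Bot \<notin> ded L ({A. Box i A \<in> w} \<union> closed_type i u)"
  proof
    assume "Bot \<in> ded L ({A. Box i A \<in> w} \<union> closed_type i u)"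
    then obtain D where D: "D \<in> closed_type i u" "Neg D \<in> ded L {A. Box i A \<in> w}"
      using ded_Un_closed_type[OF L u] by blast
    then have "Box i (Neg D) \<in> closed_type i w"
      using mcs_ded_unbox[OF L w] by (simp add: closed_type_def)
    then have "Neg D \<in> u"
      using assms(4) by (simp add: acc_def closed_type_def)
    then show False
      using D(1) mcs_Neg[OF u] by (simp add: closed_type_def)
  qed
  then obtain v where v: "mcs L v" "{A. Box i A \<in> w} \<union> closed_type i u \<subseteq> v"
    using lindenbaum[OF L] by blast
  then show ?thesis
    using closed_type_eqI[OF u v(1), of i] by (auto simp: acc_def)
qed

text \<open>\<open>Delta\<close> makes every \<open>B\<close> in the \<open>j\<close>-type of
  \<open>w\<close> imply \<open>Box i B\<close>, so \<open>acc i\<close> carries it to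
  \<open>v\<close>.\<close>

lemma acc_closed_type_eq:
  assumes "Delta \<subseteq> L" "mcs L w" "mcs L v" "acc i w v" "j \<noteq> i"
  shows "closed_type j v = closed_type j w"
proof (rule closed_type_eqI[OF assms(2,3)], rule subsetI)
  fix B assume B: "B \<in> closed_type j w"
  then have "B \<^bold>\<rightarrow> Box i B \<in> Delta"
    using assms(5) unfolding Delta_def closed_type_def by (cases i; cases j) auto
  then show "B \<in> v"
    using B assms mcs_logic[OF assms(2)] mcs_mp[OF assms(2)]
    unfolding acc_def closed_type_def by blast
qed


section \<open>Spaces of timed histories\<close>

text \<open>Histories list the latest entry first.\<close>

definition later :: "(nat \<times> 'w) list set \<Rightarrow> nat \<Rightarrow> (nat \<times> 'w) list \<Rightarrow> (nat \<times> 'w) list set" where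
  "later P k a = {g @ a | g. g @ a \<in> P \<and> (\<forall>t\<in>fst ` set g. k \<le> t)}"

text \<open>The map \<open>e\<close> encodes histories in a given point type. A set
  \<open>later P k a\<close> contains \<open>a\<close>, so it serves as an ordinary neighborhood;
  the derivational reading removes \<open>a\<close> afterwards.\<close>

definition later_topology :: "((nat \<times> 'w) list \<Rightarrow> 'a) \<Rightarrow> (nat \<times> 'w) list set \<Rightarrow> 'a topology" where
  "later_topology e P =
     topology (\<lambda>S. S \<subseteq> e ` P \<and> (\<forall>a\<in>P. e a \<in> S \<longrightarrow> (\<exists>k. e ` later P k a \<subseteq> S)))"

lemma later_subset: "later P k a \<subseteq> P"
  by (auto simp: later_def)

lemma self_in_later: "a \<in> P \<Longrightarrow> a \<in> later P k a"
  by (simp add: later_def)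

lemma later_antimono: "k \<le> k' \<Longrightarrow> later P k' a \<subseteq> later P k a"
  unfolding later_def by (auto dest: order_trans)

lemma later_trans:
  assumes "b \<in> later P k a"
  shows "later P k b \<subseteq> later P k a"
proof
  fix c assume "c \<in> later P k b"
  then obtain g h where "c = g @ h @ a" "c \<in> P" "\<forall>t\<in>fst ` set g. k \<le> t" "\<forall>t\<in>fst ` set h. k \<le> t"
    using assms by (auto simp: later_def)
  then show "c \<in> later P k a"
    unfolding later_def mem_Collect_eq by (intro exI[of _ "g @ h"]) auto
qed

text \<open>Extensions of a proper extension of \<open>a\<close> are longer than \<open>a\<close>,
  so none comes back to \<open>a\<close>. Axiom 4 for punctured neighborhoods rests on this.\<close>

lemma later_punctured:
  assumes "b \<in> later P k a - {a}"
  shows "later P k b \<subseteq> later P k a - {a}"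
  using later_trans[of b P k a] assms by (auto simp: later_def)

lemma openin_later_topology:
  "openin (later_topology e P) S \<longleftrightarrow>
     S \<subseteq> e ` P \<and> (\<forall>a\<in>P. e a \<in> S \<longrightarrow> (\<exists>k. e ` later P k a \<subseteq> S))"
proof -
  have "istopology (\<lambda>S. S \<subseteq> e ` P \<and> (\<forall>a\<in>P. e a \<in> S \<longrightarrow> (\<exists>k. e ` later P k a \<subseteq> S)))"
    unfolding istopology_def
  proof (intro conjI allI impI ballI)
    fix S T a
    assume S: "S \<subseteq> e ` P \<and> (\<forall>a\<in>P. e a \<in> S \<longrightarrow> (\<exists>k. e ` later P k a \<subseteq> S))"
      and T: "T \<subseteq> e ` P \<and> (\<forall>a\<in>P. e a \<in> T \<longrightarrow> (\<exists>k. e ` later P k a \<subseteq> T))"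
      and a: "a \<in> P" "e a \<in> S \<inter> T"
    obtain k l where "e ` later P k a \<subseteq> S" "e ` later P l a \<subseteq> T"
      using S T a by blast
    then have "e ` later P (max k l) a \<subseteq> S \<inter> T"
      using later_antimono[of k "max k l" P a] later_antimono[of l "max k l" P a] by fastforce
    then show "\<exists>k. e ` later P k a \<subseteq> S \<inter> T" ..
  next
    fix \<K> a
    assume K: "\<forall>K\<in>\<K>. K \<subseteq> e ` P \<and> (\<forall>a\<in>P. e a \<in> K \<longrightarrow> (\<exists>k. e ` later P k a \<subseteq> K))"
      and a: "a \<in> P" "e a \<in> \<Union>\<K>"
    obtain K where "K \<in> \<K>" "e a \<in> K" using a(2) by blast
    then obtain k where "e ` later P k a \<subseteq> K" using K a(1) by blast
    then show "\<exists>k. e ` later P k a \<subseteq> \<Union>\<K>" using \<open>K \<in> \<K>\<close> by blast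
  qed auto
  then show ?thesis
    unfolding later_topology_def by simp
qed

lemma topspace_later_topology: "topspace (later_topology e P) = e ` P"
proof -
  have "openin (later_topology e P) (e ` P)"
    unfolding openin_later_topology using later_subset by blast
  moreover have "topspace (later_topology e P) \<subseteq> e ` P"
    using openin_topspace[of "later_topology e P"] unfolding openin_later_topology by simp
  ultimately show ?thesis
    by (simp add: openin_subset subset_antisym)
qed

text \<open>By transitivity the images of the sets \<open>later P k a\<close> are open, so once
  punctured they form a base of the derivational filter; by injectivity, removing \<open>e a\<close>
  from an image amounts to removing \<open>a\<close>.\<close>

lemma nbhds_later_topology:
  assumes e: "inj_on e P" and a: "a \<in> P"
  shows "U \<in> nbhds (deriv_nframe (later_topology e P)) () (e a) \<longleftrightarrow>
    U \<subseteq> e ` P \<and> (\<exists>k. e ` (later P k a - {a}) \<subseteq> U)" (is "?l \<longleftrightarrow> ?r")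
proof
  assume ?l
  then obtain U' where U': "U \<subseteq> e ` P" "openin (later_topology e P) U'" "e a \<in> U'" "U' - {e a} \<subseteq> U"
    by (auto simp: deriv_nframe_def topspace_later_topology)
  then obtain k where "e ` later P k a \<subseteq> U'"
    using a unfolding openin_later_topology by blast
  moreover have "e b \<noteq> e a" if "b \<in> later P k a - {a}" for b
    using that a e later_subset[of P k a] by (auto dest: inj_onD)
  ultimately have "e ` (later P k a - {a}) \<subseteq> U"
    using U'(4) by auto
  then show ?r using U'(1) by blast
next
  assume ?r
  then obtain k where k: "U \<subseteq> e ` P" "e ` (later P k a - {a}) \<subseteq> U"
    by blast
  have "openin (later_topology e P) (e ` later P k a)"
    unfolding openin_later_topology
  proof (intro conjI ballI impI)
    show "e ` later P k a \<subseteq> e ` P" using later_subset by blast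
  next
    fix b assume "b \<in> P" "e b \<in> e ` later P k a"
    then have "b \<in> later P k a"
      using e later_subset[of P k a] by (auto dest: inj_onD)
    then show "\<exists>k'. e ` later P k' b \<subseteq> e ` later P k a"
      using later_trans by blast
  qed
  moreover have "e a \<in> e ` later P k a"
    using self_in_later[OF a] by blast
  moreover have "e ` later P k a - {e a} \<subseteq> U"
    using k(2) by auto
  ultimately show ?l
    using k(1) by (auto simp: deriv_nframe_def topspace_later_topology)
qed

lemma bex_nbhds_later_topology:
  assumes "inj_on e P" "a \<in> P"
  shows "(\<exists>U\<in>nbhds (deriv_nframe (later_topology e P)) () (e a). \<forall>y\<in>U. \<Phi> y) \<longleftrightarrow>
    (\<exists>k. \<forall>b\<in>later P k a - {a}. \<Phi> (e b))"
proof
  assume "\<exists>U\<in>nbhds (deriv_nframe (later_topology e P)) () (e a). \<forall>y\<in>U. \<Phi> y"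
  then show "\<exists>k. \<forall>b\<in>later P k a - {a}. \<Phi> (e b)"
    unfolding Bex_def nbhds_later_topology[OF assms] by blast
next
  assume "\<exists>k. \<forall>b\<in>later P k a - {a}. \<Phi> (e b)"
  then obtain k where k: "\<forall>b\<in>later P k a - {a}. \<Phi> (e b)" ..
  have "e ` (later P k a - {a}) \<in> nbhds (deriv_nframe (later_topology e P)) () (e a)"
    unfolding nbhds_later_topology[OF assms] using later_subset[of P k a] by blast
  then show "\<exists>U\<in>nbhds (deriv_nframe (later_topology e P)) () (e a). \<forall>y\<in>U. \<Phi> y"
    by (rule rev_bexI) (use k in blast)
qed

text \<open>A punctured basic neighborhood includes the punctured basic neighborhoods, with the same
  \<open>k\<close>, of all its members.\<close>

lemma d_models_K4_later_topology:
  assumes e: "inj_on e P" and "P \<noteq> {}"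
  shows "d_models (later_topology e P) K4"
proof (rule d_models_K4I)
  show "topspace (later_topology e P) \<noteq> {}"
    using assms(2) by (simp add: topspace_later_topology)
  let ?F = "deriv_nframe (later_topology e P)"
  have sat_Box: "sat ?F V (e a) (Box i A) \<longleftrightarrow> (\<exists>k. \<forall>b\<in>later P k a - {a}. sat ?F V (e b) A)"
    if "a \<in> P" for V a A i
    using bex_nbhds_later_topology[OF e that, of "\<lambda>y. sat ?F V y A"] by (cases i) simp
  have "sat ?F V (e a) (Box () (Box () A))" if a: "a \<in> P" and box: "sat ?F V (e a) (Box () A)" for V a A
  proof -
    obtain k where k: "\<forall>b\<in>later P k a - {a}. sat ?F V (e b) A"
      using box unfolding sat_Box[OF a] by blast
    have "sat ?F V (e b) (Box () A)" if b: "b \<in> later P k a - {a}" for b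
    proof -
      have "b \<in> P" using b later_subset by blast
      then show ?thesis
        using k later_punctured[OF b] unfolding sat_Box[OF \<open>b \<in> P\<close>] by blast
    qed
    then show ?thesis
      unfolding sat_Box[OF a] by blast
  qed
  then show "valid ?F (Box () (Letter 0) \<^bold>\<rightarrow> Box () (Box () (Letter 0)))"
    by (auto simp: valid_def deriv_nframe_def topspace_later_topology simp del: sat.simps(4))
qed

text \<open>Derivationally, \<open>Neg (Box () Bot)\<close> says that no point is isolated.\<close>

lemma d_models_D4_later_topology:
  assumes e: "inj_on e P" and "P \<noteq> {}" and later: "\<And>k a. a \<in> P \<Longrightarrow> later P k a - {a} \<noteq> {}"
  shows "d_models (later_topology e P) D4"
proof (rule d_models_D4I)
  show "topspace (later_topology e P) \<noteq> {}"
    using assms(2) by (simp add: topspace_later_topology)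
  show "d_models (later_topology e P) K4"
    by (rule d_models_K4_later_topology[OF assms(1,2)])
  let ?F = "deriv_nframe (later_topology e P)"
  have "\<not> sat ?F V (e a) (Box () Bot)" if "a \<in> P" for V a
    using bex_nbhds_later_topology[OF e that, of "\<lambda>y. False"] later[OF that] by auto
  then show "valid ?F (Neg (Box () Bot))"
    by (auto simp: valid_def deriv_nframe_def topspace_later_topology simp del: sat.simps(4))
qed


section \<open>Merging two histories\<close>

text \<open>What the merging needs of the canonical model, stated for a set \<open>W\<close> of
  worlds so that a countable submodel qualifies.\<close>

locale countermodel =
  fixes W :: "modality fm set set" and w0 :: "modality fm set"
  assumes w0: "w0 \<in> W"
    and Bot_notin: "w \<in> W \<Longrightarrow> Bot \<notin> w"
    and Imp_iff: "w \<in> W \<Longrightarrow> A \<^bold>\<rightarrow> B \<in> w \<longleftrightarrow> (A \<in> w \<longrightarrow> B \<in> w)"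
    and Box_witness: "w \<in> W \<Longrightarrow> Box i A \<notin> w \<Longrightarrow> \<exists>v\<in>W. acc i w v \<and> A \<notin> v"
    and trans: "u \<in> W \<Longrightarrow> acc i u v \<Longrightarrow> acc i v w \<Longrightarrow> acc i u w"
    and lift: "w \<in> W \<Longrightarrow> u \<in> W \<Longrightarrow> acc i (closed_type i w) (closed_type i u) \<Longrightarrow>
      \<exists>v\<in>W. acc i w v \<and> closed_type i v = closed_type i u"
    and other_type: "w \<in> W \<Longrightarrow> v \<in> W \<Longrightarrow> acc i w v \<Longrightarrow> j \<noteq> i \<Longrightarrow> closed_type j v = closed_type j w"
begin

text \<open>
  The world \<open>u\<close> itself is preferred when it is accessible, so that every successor of \<open>w\<close> is the
  result of some move.
\<close>

definition step :: "modality \<Rightarrow> modality fm set \<Rightarrow> modality fm set \<Rightarrow> modality fm set" where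
  "step i w u = (if acc i w u then u
     else SOME v. v \<in> W \<and> acc i w v \<and> closed_type i v = closed_type i u)"

lemma step:
  assumes "w \<in> W" "u \<in> W" "acc i (closed_type i w) (closed_type i u)"
  shows "step i w u \<in> W" "acc i w (step i w u)" "closed_type i (step i w u) = closed_type i u"
proof -
  have "step i w u \<in> W \<and> acc i w (step i w u) \<and> closed_type i (step i w u) = closed_type i u"
  proof (cases "acc i w u")
    case True
    then show ?thesis using assms by (simp add: step_def)
  next
    case False
    have "\<exists>v. v \<in> W \<and> acc i w v \<and> closed_type i v = closed_type i u"
      using lift[OF assms] by blast
    from someI_ex[OF this] show ?thesis
      using False by (simp add: step_def)
  qed
  then show "step i w u \<in> W" "acc i w (step i w u)" "closed_type i (step i w u) = closed_type i u"
    by simp_all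
qed

text \<open>The world reached by a merged run may differ from this label, but it shares the label's
  closed type for the moving modality.\<close>

definition latest :: "(nat \<times> modality fm set) list \<Rightarrow> modality fm set" where
  "latest a = (case a of [] \<Rightarrow> w0 | p # _ \<Rightarrow> snd p)"

text \<open>Legality of a move refers to the types of labels only, never to the world reached, so it
  is independent of the other coordinate.\<close>

primrec path :: "modality \<Rightarrow> (nat \<times> modality fm set) list \<Rightarrow> bool" where
  "path i [] \<longleftrightarrow> True"
| "path i (p # a) \<longleftrightarrow> snd p \<in> W \<and> acc i (closed_type i (latest a)) (closed_type i (snd p)) \<and> path i a"

text \<open>The head with the larger stamp is peeled off first, that is, executed last; in a tie the
  vertical move is the last one. Only heads are compared, and stamps within one history need not
  increase.\<close>

fun run :: "(nat \<times> modality fm set) list \<Rightarrow> (nat \<times> modality fm set) list \<Rightarrow> modality fm set" where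
  "run [] [] = w0"
| "run ((n, v) # a) [] = step M1 (run a []) v"
| "run [] ((m, u) # b) = step M2 (run [] b) u"
| "run ((n, v) # a) ((m, u) # b) =
    (if m < n then step M1 (run a ((m, u) # b)) v else step M2 (run ((n, v) # a) b) u)"

lemma latest_simps [simp]: "latest [] = w0" "latest (p # a) = snd p"
  by (simp_all add: latest_def)

lemma latest_in: "path i a \<Longrightarrow> latest a \<in> W"
  using w0 by (cases a) auto

lemma path_appendD: "path i (g @ a) \<Longrightarrow> path i a"
  by (induction g) auto

lemma step_other:
  assumes "w \<in> W" "u \<in> W" "acc i (closed_type i w) (closed_type i u)" "j \<noteq> i"
  shows "closed_type j (step i w u) = closed_type j w"
  using other_type[OF assms(1) step(1,2)[OF assms(1-3)] assms(4)] .

text \<open>A move takes over the type of its label in its own modality and keeps the other type.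
  Thus the condition in \<open>path\<close> supplies what \<open>step\<close> requires at every
  stage of the merge.\<close>

lemma run_type:
  "path M1 a \<Longrightarrow> path M2 b \<Longrightarrow> run a b \<in> W \<and>
     closed_type M1 (run a b) = closed_type M1 (latest a) \<and>
     closed_type M2 (run a b) = closed_type M2 (latest b)"
  by (induction a b rule: run.induct) (simp_all add: w0 step step_other)

section \<open>Boxes along merged histories\<close>

text \<open>All moves of \<open>g\<close> are later than those of \<open>b\<close>, so the merge
  executes them last and transitivity contracts them to one step. The order is strict because ties
  go to the vertical move; \<open>g\<close> is nonempty because \<open>acc\<close> need not be
  reflexive.\<close>

lemma run_extend_M1:
  assumes "path M1 (g @ a)" "path M2 b" "\<And>s t. t \<in> fst ` set g \<Longrightarrow> s \<in> fst ` set b \<Longrightarrow> s < t" "g \<noteq> []"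
  shows "acc M1 (run a b) (run (g @ a) b)"
  using assms
proof (induction g)
  case (Cons p g)
  have p: "path M1 (g @ a)" "snd p \<in> W"
    "acc M1 (closed_type M1 (latest (g @ a))) (closed_type M1 (snd p))"
    using Cons.prems(1) by auto
  have "run ((p # g) @ a) b = step M1 (run (g @ a) b) (snd p)"
    using Cons.prems(3) by (cases p; cases b) auto
  then have s: "acc M1 (run (g @ a) b) (run ((p # g) @ a) b)"
    using step(2) run_type[OF p(1) Cons.prems(2)] p(2,3) by simp
  show ?case
  proof (cases "g = []")
    case True
    then show ?thesis using s by simp
  next
    case False
    then have "acc M1 (run a b) (run (g @ a) b)"
      using Cons.IH p(1) Cons.prems(2,3) by simp
    then show ?thesis
      using trans s run_type[OF path_appendD[OF p(1)] Cons.prems(2)] by blast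
  qed
qed simp

lemma run_extend_M2:
  assumes "path M2 (g @ b)" "path M1 a" "\<And>s t. t \<in> fst ` set g \<Longrightarrow> s \<in> fst ` set a \<Longrightarrow> s < t" "g \<noteq> []"
  shows "acc M2 (run a b) (run a (g @ b))"
  using assms
proof (induction g)
  case (Cons p g)
  have p: "path M2 (g @ b)" "snd p \<in> W"
    "acc M2 (closed_type M2 (latest (g @ b))) (closed_type M2 (snd p))"
    using Cons.prems(1) by auto
  \<comment> \<open>For nonempty \<open>a\<close>, its head is older than \<open>p\<close>, which
    excludes the horizontal branch of \<open>run\<close>.\<close>
  have "run a ((p # g) @ b) = step M2 (run a (g @ b)) (snd p)"
    using Cons.prems(3)[of "fst p" "fst (hd a)"] by (cases p; cases a) auto
  then have s: "acc M2 (run a (g @ b)) (run a ((p # g) @ b))"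
    using step(2) run_type[OF Cons.prems(2) p(1)] p(2,3) by simp
  show ?case
  proof (cases "g = []")
    case True
    then show ?thesis using s by simp
  next
    case False
    then have "acc M2 (run a b) (run a (g @ b))"
      using Cons.IH p(1) Cons.prems(2,3) by simp
    then show ?thesis
      using trans s run_type[OF Cons.prems(2) path_appendD[OF p(1)]] by blast
  qed
qed simp

lemma time_bound: "\<exists>k. \<forall>s\<in>fst ` set (b :: (nat \<times> 'w) list). s < k"
  using finite_nat_set_iff_bounded[of "fst ` set b"] by simp

text \<open>Extensions of \<open>a\<close> beyond the stamps of \<open>b\<close> are moves at the
  very end of the run, hence lead to accessible worlds; conversely one such move reaches any given
  accessible world of \<open>W\<close>.\<close>

lemma Box_M1_run:
  assumes a: "path M1 a" and b: "path M2 b"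
  shows "Box M1 A \<in> run a b \<longleftrightarrow> (\<exists>k. \<forall>a'\<in>later (Collect (path M1)) k a - {a}. A \<in> run a' b)"
proof
  assume box: "Box M1 A \<in> run a b"
  obtain k where k: "\<forall>s\<in>fst ` set b. s < k" using time_bound by blast
  have "A \<in> run a' b" if a': "a' \<in> later (Collect (path M1)) k a - {a}" for a'
  proof -
    obtain g where g: "a' = g @ a" "path M1 (g @ a)" "\<forall>t\<in>fst ` set g. k \<le> t" "g \<noteq> []"
      using a' unfolding later_def by blast
    have "acc M1 (run a b) (run (g @ a) b)"
      by (rule run_extend_M1[OF g(2) b _ g(4)]) (use k g(3) in \<open>meson less_le_trans\<close>)
    then show ?thesis using box g(1) by (simp add: acc_def)
  qed
  then show "\<exists>k. \<forall>a'\<in>later (Collect (path M1)) k a - {a}. A \<in> run a' b" by blast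
next
  assume "\<exists>k. \<forall>a'\<in>later (Collect (path M1)) k a - {a}. A \<in> run a' b"
  then obtain k where k: "\<forall>a'\<in>later (Collect (path M1)) k a - {a}. A \<in> run a' b" ..
  obtain l where l: "\<forall>s\<in>fst ` set b. s < l" using time_bound by blast
  show "Box M1 A \<in> run a b"
  proof (rule ccontr)
    assume "Box M1 A \<notin> run a b"
    then obtain v where v: "v \<in> W" "acc M1 (run a b) v" "A \<notin> v"
      using Box_witness run_type[OF a b] by blast
    \<comment> \<open>The stamp \<open>max k l\<close> lies both in the given neighborhood and
      beyond all of \<open>b\<close>.\<close>
    let ?a = "(max k l, v) # a"
    have "path M1 ?a"
      using a v(1) acc_closed_type[OF v(2)] run_type[OF a b] by simp
    then have "?a \<in> later (Collect (path M1)) k a - {a}"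
      unfolding later_def by (auto intro!: exI[of _ "[(max k l, v)]"])
    \<comment> \<open>The new move is executed last, and \<open>step\<close> returns
      \<open>v\<close> itself because \<open>v\<close> is accessible.\<close>
    moreover have "run ?a b = v"
      using l v(2) by (cases b) (auto simp: step_def less_max_iff_disj)
    ultimately show False using k v(3) by blast
  qed
qed

lemma Box_M2_run:
  assumes a: "path M1 a" and b: "path M2 b"
  shows "Box M2 A \<in> run a b \<longleftrightarrow> (\<exists>k. \<forall>b'\<in>later (Collect (path M2)) k b - {b}. A \<in> run a b')"
proof
  assume box: "Box M2 A \<in> run a b"
  obtain k where k: "\<forall>s\<in>fst ` set a. s < k" using time_bound by blast
  have "A \<in> run a b'" if b': "b' \<in> later (Collect (path M2)) k b - {b}" for b'
  proof -
    obtain g where g: "b' = g @ b" "path M2 (g @ b)" "\<forall>t\<in>fst ` set g. k \<le> t" "g \<noteq> []"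
      using b' unfolding later_def by blast
    have "acc M2 (run a b) (run a (g @ b))"
      by (rule run_extend_M2[OF g(2) a _ g(4)]) (use k g(3) in \<open>meson less_le_trans\<close>)
    then show ?thesis using box g(1) by (simp add: acc_def)
  qed
  then show "\<exists>k. \<forall>b'\<in>later (Collect (path M2)) k b - {b}. A \<in> run a b'" by blast
next
  assume "\<exists>k. \<forall>b'\<in>later (Collect (path M2)) k b - {b}. A \<in> run a b'"
  then obtain k where k: "\<forall>b'\<in>later (Collect (path M2)) k b - {b}. A \<in> run a b'" ..
  obtain l where l: "\<forall>s\<in>fst ` set a. s < l" using time_bound by blast
  show "Box M2 A \<in> run a b"
  proof (rule ccontr)
    assume "Box M2 A \<notin> run a b"
    then obtain v where v: "v \<in> W" "acc M2 (run a b) v" "A \<notin> v"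
      using Box_witness run_type[OF a b] by blast
    let ?b = "(max k l, v) # b"
    have "path M2 ?b"
      using b v(1) acc_closed_type[OF v(2)] run_type[OF a b] by simp
    then have "?b \<in> later (Collect (path M2)) k b - {b}"
      unfolding later_def by (auto intro!: exI[of _ "[(max k l, v)]"])
    moreover have "run a ?b = v"
      using l v(2) by (cases a) (auto simp: step_def less_max_iff_disj)
    ultimately show False using k v(3) by blast
  qed
qed

text \<open>Letters at a product point are copied from the merged world, unambiguously since the
  encodings are injective. Boxes reduce to \<open>Box_M1_run\<close> and \<open>Box_M2_run\<close>
  through the base of punctured neighborhoods.\<close>

lemma truth:
  fixes e1 :: "(nat \<times> modality fm set) list \<Rightarrow> 'a" and e2 :: "(nat \<times> modality fm set) list \<Rightarrow> 'b"
  assumes e1: "inj_on e1 (Collect (path M1))" and e2: "inj_on e2 (Collect (path M2))"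
  defines "V \<equiv> \<lambda>p. {(e1 a, e2 b) | a b. path M1 a \<and> path M2 b \<and> Letter p \<in> run a b}"
  assumes "path M1 a" "path M2 b"
  shows "sat (nprod (deriv_nframe (later_topology e1 (Collect (path M1))))
      (deriv_nframe (later_topology e2 (Collect (path M2))))) V (e1 a, e2 b) A \<longleftrightarrow> A \<in> run a b"
    (is "sat (nprod ?F1 ?F2) _ _ _ \<longleftrightarrow> _")
  using assms(4,5)
proof (induction A arbitrary: a b)
  case (Letter p)
  then show ?case
    using inj_onD[OF e1] inj_onD[OF e2] by (fastforce simp: V_def)
next
  case Bot
  then show ?case using Bot_notin run_type by simp
next
  case (Imp A B)
  then show ?case using Imp_iff run_type by simp
next
  case (Box i A)
  have p: "e1 a \<in> points ?F1" "e2 b \<in> points ?F2"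
    using Box.prems by (auto simp: deriv_nframe_def topspace_later_topology)
  have "topspace (later_topology e1 (Collect (path M1))) \<noteq> {}"
    "topspace (later_topology e2 (Collect (path M2))) \<noteq> {}"
    using p by (auto simp: deriv_nframe_def)
  note F = this[THEN is_nframe_deriv_nframe]
  show ?case
  proof (cases i)
    case M1
    have "sat (nprod ?F1 ?F2) V (e1 a, e2 b) (Box M1 A) \<longleftrightarrow>
        (\<exists>k. \<forall>a'\<in>later (Collect (path M1)) k a - {a}. sat (nprod ?F1 ?F2) V (e1 a', e2 b) A)"
      unfolding sat_nprod_M1[OF F(1) p]
      by (rule bex_nbhds_later_topology[OF e1]) (simp add: Box.prems)
    also have "\<dots> \<longleftrightarrow> (\<exists>k. \<forall>a'\<in>later (Collect (path M1)) k a - {a}. A \<in> run a' b)"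
    proof (intro ex_cong1 ball_cong refl)
      fix k a' assume "a' \<in> later (Collect (path M1)) k a - {a}"
      then have "path M1 a'" using later_subset by blast
      then show "sat (nprod ?F1 ?F2) V (e1 a', e2 b) A \<longleftrightarrow> A \<in> run a' b"
        using Box.IH Box.prems by blast
    qed
    finally show ?thesis
      unfolding M1 Box_M1_run[OF Box.prems] .
  next
    case M2
    have "sat (nprod ?F1 ?F2) V (e1 a, e2 b) (Box M2 A) \<longleftrightarrow>
        (\<exists>k. \<forall>b'\<in>later (Collect (path M2)) k b - {b}. sat (nprod ?F1 ?F2) V (e1 a, e2 b') A)"
      unfolding sat_nprod_M2[OF F(2) p]
      by (rule bex_nbhds_later_topology[OF e2]) (simp add: Box.prems)
    also have "\<dots> \<longleftrightarrow> (\<exists>k. \<forall>b'\<in>later (Collect (path M2)) k b - {b}. A \<in> run a b')"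
    proof (intro ex_cong1 ball_cong refl)
      fix k b' assume "b' \<in> later (Collect (path M2)) k b - {b}"
      then have "path M2 b'" using later_subset by blast
      then show "sat (nprod ?F1 ?F2) V (e1 a, e2 b') A \<longleftrightarrow> A \<in> run a b'"
        using Box.IH Box.prems by blast
    qed
    finally show ?thesis
      unfolding M2 Box_M2_run[OF Box.prems] .
  qed
qed

text \<open>One more move at time \<open>k\<close> suffices: \<open>latest a\<close> lacks
  \<open>Box i Bot\<close> and therefore has a successor.\<close>

lemma serial_later:
  assumes "\<And>w. w \<in> W \<Longrightarrow> Box i Bot \<notin> w" "path i a"
  shows "later (Collect (path i)) k a - {a} \<noteq> {}"
proof -
  obtain v where v: "v \<in> W" "acc i (latest a) v"
    using assms latest_in Box_witness by blast
  then have "path i ((k, v) # a)"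
    using assms(2) acc_closed_type by simp
  then have "(k, v) # a \<in> later (Collect (path i)) k a - {a}"
    unfolding later_def by (auto intro!: exI[of _ "[(k, v)]"])
  then show ?thesis by blast
qed

lemma countable_path:
  assumes "countable W"
  shows "countable (Collect (path i))"
proof -
  have "a \<in> lists (UNIV \<times> W)" if "path i a" for a
    using that by (induction a) (auto simp: mem_Times_iff)
  then have "Collect (path i) \<subseteq> lists (UNIV \<times> W)"
    by blast
  then show ?thesis
    using assms by (auto intro: countable_subset)
qed

end

section \<open>Countable submodels of the canonical model\<close>

text \<open>A Loewenheim-Skolem argument: \<open>{w0}\<close> is closed in \<omega> stages under the
  countably many functions \<open>f c\<close>.\<close>

lemma countable_closure:
  fixes f :: "'c::countable \<Rightarrow> 'w \<Rightarrow> 'w \<Rightarrow> 'w"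
  assumes "w0 \<in> M" and f: "\<And>c w u. w \<in> M \<Longrightarrow> u \<in> M \<Longrightarrow> f c w u \<in> M"
  shows "\<exists>W\<subseteq>M. countable W \<and> w0 \<in> W \<and> (\<forall>c. \<forall>w\<in>W. \<forall>u\<in>W. f c w u \<in> W)"
proof -
  define F where "F X = X \<union> (\<lambda>(c, w, u). f c w u) ` (UNIV \<times> X \<times> X)" for X
  define W where "W n = (F ^^ n) {w0}" for n
  have W_Suc: "W (Suc n) = F (W n)" for n by (simp add: W_def)
  have "countable (W n)" for n
  proof (induction n)
    case 0
    then show ?case by (simp add: W_def)
  next
    case (Suc n)
    then show ?case unfolding W_Suc F_def by (intro countable_Un countable_image countable_SIGMA) auto
  qed
  then have "countable (\<Union>n. W n)" by simp
  moreover have "W n \<subseteq> M" for n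
  proof (induction n)
    case 0
    then show ?case using assms(1) by (simp add: W_def)
  next
    case (Suc n)
    then show ?case unfolding W_Suc F_def using f[OF subsetD subsetD] by auto
  qed
  moreover have "w0 \<in> (\<Union>n. W n)"
    using UN_I[of 0 UNIV w0 W] by (simp add: W_def)
  moreover have "f c w u \<in> (\<Union>n. W n)" if wu: "w \<in> (\<Union>n. W n)" "u \<in> (\<Union>n. W n)" for c w u
  proof -
    have mono: "W m \<subseteq> W n" if "m \<le> n" for m n
      using that by (rule lift_Suc_mono_le[rotated]) (auto simp: W_Suc F_def)
    obtain m n where "w \<in> W m" "u \<in> W n" using wu by blast
    then have "w \<in> W (max m n)" "u \<in> W (max m n)"
      using mono[of m "max m n"] mono[of n "max m n"] by auto
    then have "f c w u \<in> W (Suc (max m n))"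
      unfolding W_Suc F_def by force
    then show ?thesis by blast
  qed
  ultimately show ?thesis by (intro exI[of _ "\<Union>n. W n"]) auto
qed

text \<open>The existential properties of the canonical model become functions, and a countable set
  closed under them keeps the witnesses. The remaining properties hold of all maximal consistent
  sets and pass to subsets.\<close>

lemma countable_countermodel:
  assumes L: "normal_logic L" and four: "\<And>i A. Box i A \<^bold>\<rightarrow> Box i (Box i A) \<in> L"
    and Delta: "Delta \<subseteq> L" and w0: "mcs L w0"
  shows "\<exists>W\<subseteq>{w. mcs L w}. countable W \<and> countermodel W w0"
proof -
  \<comment> \<open>\<open>Inl\<close> codes demand a witness against a box at \<open>w\<close>,
    \<open>Inr\<close> codes a successor of \<open>w\<close> with the type of \<open>u\<close>. A
    demand is vacuous when its premise fails, so every code can be met.\<close>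
  define good where "good c w u v \<longleftrightarrow> (case c of
      Inl (i, A) \<Rightarrow> Box i A \<notin> w \<longrightarrow> acc i w v \<and> A \<notin> v
    | Inr i \<Rightarrow> acc i (closed_type i w) (closed_type i u) \<longrightarrow>
        acc i w v \<and> closed_type i v = closed_type i u)"
    for c :: "(modality \<times> modality fm) + modality" and w u v
  have ex: "\<exists>v. mcs L v \<and> good c w u v" if "mcs L w" "mcs L u" for c w u
  proof (cases c)
    case (Inl p)
    then show ?thesis
      using acc_exists[OF L that(1), of "fst p" "snd p"] that(1) unfolding good_def
      by (cases p) auto
  next
    case (Inr i)
    then show ?thesis
      using acc_lift[OF L that, of i] that(1) unfolding good_def by auto
  qed
  define f where "f c w u = (SOME v. mcs L v \<and> good c w u v)" for c w u
  have f: "mcs L (f c w u) \<and> good c w u (f c w u)" if "mcs L w" "mcs L u" for c w u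
    unfolding f_def by (rule someI_ex[OF ex[OF that]])
  obtain W where W: "W \<subseteq> {w. mcs L w}" "countable W" "w0 \<in> W"
    and closed: "\<And>c w u. w \<in> W \<Longrightarrow> u \<in> W \<Longrightarrow> f c w u \<in> W"
    using countable_closure[of w0 "{w. mcs L w}" f] w0 f unfolding mem_Collect_eq by metis
  have mcs: "mcs L w" if "w \<in> W" for w using W(1) that by blast
  have good: "good c w u (f c w u)" if "w \<in> W" "u \<in> W" for c w u
    using f mcs that by blast
  have "countermodel W w0"
  proof
    show "\<exists>v\<in>W. acc i w v \<and> A \<notin> v" if "w \<in> W" "Box i A \<notin> w" for w i A
      using good[OF that(1) that(1), of "Inl (i, A)"] closed[OF that(1) that(1)] that(2)
      unfolding good_def by auto
    show "\<exists>v\<in>W. acc i w v \<and> closed_type i v = closed_type i u"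
      if "w \<in> W" "u \<in> W" "acc i (closed_type i w) (closed_type i u)" for w u i
      using good[OF that(1,2), of "Inr i"] closed[OF that(1,2)] that(3)
      unfolding good_def by auto
    show "acc i u w" if "u \<in> W" "acc i u v" "acc i v w" for i u v w
      using acc_trans[OF mcs[OF that(1)] four that(2,3)] .
    show "closed_type j v = closed_type j w" if "w \<in> W" "v \<in> W" "acc i w v" "j \<noteq> i" for i j w v
      using acc_closed_type_eq[OF Delta mcs[OF that(1)] mcs[OF that(2)] that(3,4)] .
  qed (use W(3) mcs mcs_Bot mcs_Imp[OF L] in blast)+
  then show ?thesis using W by blast
qed

section \<open>Completeness for the product\<close>

lemma ex_inj_on_infinite:
  assumes "countable A" "infinite (UNIV :: 'a set)"
  shows "\<exists>f :: 'b \<Rightarrow> 'a. inj_on f A"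
proof -
  obtain g :: "nat \<Rightarrow> 'a" where "inj g"
    using infinite_countable_subset[OF assms(2)] by blast
  moreover obtain h :: "'b \<Rightarrow> nat" where "inj_on h A"
    using assms(1) by (auto simp: countable_def)
  ultimately show ?thesis
    using comp_inj_on[of h A g] inj_on_subset[of g UNIV "h ` A"] by blast
qed

text \<open>A formula outside \<open>L\<close> is refuted at the pair of empty histories over a
  countable countermodel; the histories, being countable, embed in any infinite point type.\<close>

lemma d_product_complete:
  assumes inf: "infinite (UNIV :: 'a set)" "infinite (UNIV :: 'b set)"
    and L: "normal_logic L" "Delta \<subseteq> L"
    and L1: "L1 \<in> {K4, D4}" "relabel (\<lambda>_. M1) ` L1 \<subseteq> L"
    and L2: "L2 \<in> {K4, D4}" "relabel (\<lambda>_. M2) ` L2 \<subseteq> L"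
  shows "d_product TYPE('a) TYPE('b) L1 L2 \<subseteq> L"
proof
  fix A assume A: "A \<in> d_product TYPE('a) TYPE('b) L1 L2"
  show "A \<in> L"
  proof (rule ccontr)
    assume "A \<notin> L"
    then obtain w0 where u0: "mcs L w0" "A \<notin> w0"
      using mcs_refuting[OF L(1)] by blast
    have "K4 \<subseteq> L1" "K4 \<subseteq> L2"
      using L1(1) L2(1) K4_subset_D4 by auto
    then have "relabel (\<lambda>_. M1) ` K4 \<subseteq> L" "relabel (\<lambda>_. M2) ` K4 \<subseteq> L"
      using L1(2) L2(2) by (meson image_mono order_trans)+
    then have four: "Box i B \<^bold>\<rightarrow> Box i (Box i B) \<in> L" for i B
      using normal_logic_4[OF L(1)] by (cases i) auto
    obtain W where W: "W \<subseteq> {w. mcs L w}" "countable W" "countermodel W w0"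
      using countable_countermodel[OF L(1) four L(2) u0(1)] by blast
    interpret countermodel W w0 by (rule W(3))
    let ?P1 = "Collect (path M1)" and ?P2 = "Collect (path M2)"
    obtain e1 :: "(nat \<times> modality fm set) list \<Rightarrow> 'a" where e1: "inj_on e1 ?P1"
      using ex_inj_on_infinite[OF countable_path[OF W(2)] inf(1)] by blast
    obtain e2 :: "(nat \<times> modality fm set) list \<Rightarrow> 'b" where e2: "inj_on e2 ?P2"
      using ex_inj_on_infinite[OF countable_path[OF W(2)] inf(2)] by blast
    let ?X1 = "later_topology e1 ?P1" and ?X2 = "later_topology e2 ?P2"
    have ne: "[] \<in> ?P1" "[] \<in> ?P2" by simp_all
    then have k4: "d_models ?X1 K4" "d_models ?X2 K4"
      using d_models_K4_later_topology[OF e1] d_models_K4_later_topology[OF e2] by blast+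
    have serial: "Box i Bot \<notin> w" if "Neg (Box i Bot) \<in> L" "w \<in> W" for i w
      using W(1) that mcs_logic mcs_Neg by blast
    \<comment> \<open>Stated for encodings into any type, because the two coordinates have different
      point types.\<close>
    have d4: "d_models (later_topology e (Collect (path i))) D4"
      if "relabel (\<lambda>_. i) ` D4 \<subseteq> L" "inj_on e (Collect (path i))"
      for i and e :: "(nat \<times> modality fm set) list \<Rightarrow> 'c"
      by (rule d_models_D4_later_topology[OF that(2)])
        (use serial_later serial[OF relabel_D[OF that(1)]] path.simps(1) in blast)+
    have "d_models ?X1 L1"
      using L1 d4[of M1 e1] e1 k4(1) by auto
    moreover have "d_models ?X2 L2"
      using L2 d4[of M2 e2] e2 k4(2) by auto
    moreover have "topspace ?X1 \<noteq> {}" "topspace ?X2 \<noteq> {}"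
      using ne by (auto simp: topspace_later_topology simp del: path.simps)
    ultimately have valid: "valid (nprod (deriv_nframe ?X1) (deriv_nframe ?X2)) A"
      using A by (simp add: d_product_def d_models_prod_def)
    let ?V = "\<lambda>p. {(e1 a, e2 b) | a b. path M1 a \<and> path M2 b \<and> Letter p \<in> run a b}"
    have "?V p \<subseteq> points (nprod (deriv_nframe ?X1) (deriv_nframe ?X2))" for p
      by (auto simp: nprod_def deriv_nframe_def topspace_later_topology)
    moreover have "(e1 [], e2 []) \<in> points (nprod (deriv_nframe ?X1) (deriv_nframe ?X2))"
      using ne by (simp add: nprod_def deriv_nframe_def topspace_later_topology del: path.simps)
    ultimately have "sat (nprod (deriv_nframe ?X1) (deriv_nframe ?X2)) ?V (e1 [], e2 []) A"
      using valid by (simp add: valid_def)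
    \<comment> \<open>The merge of two empty histories is \<open>w0\<close>, which does not contain
      \<open>A\<close>.\<close>
    then show False
      using truth[OF e1 e2, of "[]" "[]" A] u0(2) by simp
  qed
qed

lemma d_product_eq_fusion_Delta:
  assumes "infinite (UNIV :: 'a set)" "infinite (UNIV :: 'b set)"
    and "L1 \<in> {K4, D4}" "L2 \<in> {K4, D4}"
  shows "d_product TYPE('a) TYPE('b) L1 L2 = \<langle>L1, L2\<rangle>"
proof
  have "L1 \<^bold>* L2 \<subseteq> \<langle>L1, L2\<rangle>" "Delta \<subseteq> \<langle>L1, L2\<rangle>"
    unfolding fusion_Delta_def by (rule extend_upper)+
  moreover have "normal_logic \<langle>L1, L2\<rangle>"
    unfolding fusion_Delta_def by (rule normal_logic_extend)
  ultimately show "d_product TYPE('a) TYPE('b) L1 L2 \<subseteq> \<langle>L1, L2\<rangle>"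
    using relabel_fusion[where ?L1.0=L1 and ?L2.0=L2] by (intro d_product_complete assms) auto
qed (rule fusion_Delta_subset_d_product)

lemma fusion_Delta_D4_D4: "\<langle>D4, D4\<rangle> = D4 \<^bold>* D4"
proof
  have L: "normal_logic (D4 \<^bold>* D4)"
    unfolding fusion_def by (rule normal_logic_extend)
  have "Neg (Box i Bot) \<in> D4 \<^bold>* D4" for i
    using relabel_D[OF relabel_fusion(1)] relabel_D[OF relabel_fusion(2)] by (cases i) blast+
  from Delta_subset_if_serial[OF L this] show "\<langle>D4, D4\<rangle> \<subseteq> D4 \<^bold>* D4"
    unfolding fusion_Delta_def by (intro extend_least[OF L]) auto
  show "D4 \<^bold>* D4 \<subseteq> \<langle>D4, D4\<rangle>"
    unfolding fusion_Delta_def by (rule extend_upper)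
qed

theorem theorem9p1:
  assumes "infinite (UNIV :: 'a set)" and "infinite (UNIV :: 'b set)"
  shows "d_product TYPE('a) TYPE('b) K4 K4 = \<langle>K4, K4\<rangle>
       \<and> d_product TYPE('a) TYPE('b) K4 D4 = \<langle>K4, D4\<rangle>
       \<and> d_product TYPE('a) TYPE('b) D4 K4 = \<langle>D4, K4\<rangle>
       \<and> d_product TYPE('a) TYPE('b) D4 D4 = D4 \<^bold>* D4"
  using d_product_eq_fusion_Delta[OF assms] by (simp add: fusion_Delta_D4_D4)

end
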